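(* Let $K$ be an algebraic function field in one variable with constant field $\mathbb{F}_q$, $\infty$ a fixed place of $K$ (of arbitrary degree), $A$ the ring of elements of $K$ integral outside $\infty$, $G=GL_2(A)$, $\widehat{G}=GL_2(K)$, $Z(K)$ the scalar matrices in $\widehat{G}$, and $Quinn(G)=N_{\widehat{G}}(G)/Z(K)\cdot G$. Then $Quinn(G)$ acts freely and transitively on (i) the set of $G$-conjugacy classes of subgroups of $G$ isomorphic to $GL_2(\mathbb{F}_q)$; (ii) the set of vertices $\widetilde{v}=Gv$ of the quotient graph $G\backslash\mathcal{T}$ whose stabilizers $G_v$ are isomorphic to $GL_2(\mathbb{F}_q)$.
   Context: $N_{\widehat{G}}(G)$ is the normalizer of $G$ in $\widehat{G}$. $\mathcal{T}$ is the Bruhat–Tits tree of $GL_2(K_\infty)$ ($K_\infty$ the completion at $\infty$), on which $GL_2(K_\infty)$ acts naturally, scalar matrices acting trivially; $G_v$ denotes the stabilizer of $v$ in $G$. The class of $g\in N_{\widehat{G}}(G)$ acts on conjugacy classes by sending the class of $H$ to the class of $gHg^{-1}$, and on $G\backslash\mathcal{T}$ by $Gv\mapsto Gg(v)$; these actions are well defined. *)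

theory Defs
  imports
    "HOL-Analysis.Analysis"
    "HOL-Computational_Algebra.Polynomial"
    "HOL-Algebra.Group_Action"
    "Graph_Theory.Digraph"
begin

section \<open>Function fields, places and the ring of elements integral outside a place\<close>

definition is_subring :: "'a::field set \<Rightarrow> bool" where
  "is_subring R \<longleftrightarrow> 1 \<in> R \<and> (\<forall>x\<in>R. \<forall>y\<in>R. x - y \<in> R \<and> x * y \<in> R)"

definition is_subfield :: "'a::field set \<Rightarrow> bool" where
  "is_subfield F \<longleftrightarrow> is_subring F \<and> (\<forall>x\<in>F. inverse x \<in> F)"

definition algebraic_over :: "'a::field set \<Rightarrow> 'a \<Rightarrow> bool" where
  "algebraic_over F x \<longleftrightarrow> (\<exists>p. p \<noteq> 0 \<and> (\<forall>i. coeff p i \<in> F) \<and> poly p x = 0)"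

definition adjoin :: "'a::field set \<Rightarrow> 'a \<Rightarrow> 'a set" where
  "adjoin F t = \<Inter>{L. is_subfield L \<and> F \<subseteq> L \<and> t \<in> L}"

definition finite_extension_of :: "'a::field set \<Rightarrow> bool" where
  "finite_extension_of L \<longleftrightarrow>
     (\<exists>B. finite B \<and> (\<forall>x. \<exists>c. (\<forall>b\<in>B. c b \<in> L) \<and> x = (\<Sum>b\<in>B. c b * b)))"

text \<open>The whole type \<^typ>\<open>'a\<close> is a function field in one variable whose full constant field is
  the finite field \<^term>\<open>F\<close>: it is finite over \<open>F(t)\<close> for some transcendental \<open>t\<close>, and \<^term>\<open>F\<close>
  is algebraically closed in it.\<close>

definition function_field :: "'a::field set \<Rightarrow> bool" where
  "function_field F \<longleftrightarrow>
     is_subfield F \<and> finite F \<and>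
     (\<exists>t. \<not> algebraic_over F t \<and> finite_extension_of (adjoin F t)) \<and>
     (\<forall>x. algebraic_over F x \<longrightarrow> x \<in> F)"

definition valuation_ring :: "'a::field set \<Rightarrow> bool" where
  "valuation_ring R \<longleftrightarrow> is_subring R \<and> R \<noteq> UNIV \<and> (\<forall>x. x \<in> R \<or> inverse x \<in> R)"

definition maximal_ideal :: "'a::field set \<Rightarrow> 'a set" where
  "maximal_ideal R = {x \<in> R. x = 0 \<or> inverse x \<notin> R}"

text \<open>A place is represented by its valuation ring.\<close>

definition is_place :: "'a::field set \<Rightarrow> 'a set \<Rightarrow> bool" where
  "is_place F P \<longleftrightarrow> valuation_ring P \<and> F \<subset> P"

definition integral_outside :: "'a::field set \<Rightarrow> 'a set \<Rightarrow> 'a set" where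
  "integral_outside F P = \<Inter>{Q. is_place F Q \<and> Q \<noteq> P}"


section \<open>Completion at a place\<close>

text \<open>The valuation topology attached to a valuation ring \<^term>\<open>R\<close> has the sets
  \<open>a R\<close>, for nonzero \<open>a\<close>, as a neighbourhood basis of zero. The field \<^typ>\<open>'c\<close> is a completion of
  \<^typ>\<open>'a\<close> at the place \<^term>\<open>P\<close> via the embedding \<^term>\<open>\<iota>\<close>, with ring of integers \<^term>\<open>R\<close>.\<close>

definition is_completion :: "'a::field set \<Rightarrow> ('a \<Rightarrow> 'c::field) \<Rightarrow> 'c set \<Rightarrow> bool" where
  "is_completion P \<iota> R \<longleftrightarrow>
     \<iota> 1 = 1 \<and> (\<forall>x y. \<iota> (x + y) = \<iota> x + \<iota> y) \<and> (\<forall>x y. \<iota> (x * y) = \<iota> x * \<iota> y) \<and>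
     valuation_ring R \<and>
     (\<forall>x. \<iota> x \<in> R \<longleftrightarrow> x \<in> P) \<and>
     (\<forall>z. \<forall>a. a \<noteq> 0 \<longrightarrow> (\<exists>x. z - \<iota> x \<in> (*) a ` R)) \<and>
     (\<forall>X :: nat \<Rightarrow> 'c.
        (\<forall>a. a \<noteq> 0 \<longrightarrow> (\<exists>N. \<forall>m\<ge>N. \<forall>n\<ge>N. X m - X n \<in> (*) a ` R)) \<longrightarrow>
        (\<exists>l. \<forall>a. a \<noteq> 0 \<longrightarrow> (\<exists>N. \<forall>n\<ge>N. X n - l \<in> (*) a ` R)))"


section \<open>General linear groups and the Quinn group\<close>

definition matrices_over :: "'a::field set \<Rightarrow> ('a^2^2) set" where
  "matrices_over R = {M. \<forall>i j. M $ i $ j \<in> R}"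

definition GL2 :: "'a::field set \<Rightarrow> ('a^2^2) monoid" where
  "GL2 R = \<lparr>carrier = {M \<in> matrices_over R. \<exists>N\<in>matrices_over R. M ** N = mat 1 \<and> N ** M = mat 1},
            mult = (**), one = mat 1\<rparr>"

definition scalar_matrices :: "('a::field^2^2) set" where
  "scalar_matrices = {mat c | c. c \<noteq> 0}"

abbreviation normalizer_GL2 :: "'a::field set \<Rightarrow> ('a^2^2) set" where
  "normalizer_GL2 A \<equiv> normalizer (GL2 UNIV) (carrier (GL2 A))"

abbreviation scalars_GL2 :: "'a::field set \<Rightarrow> ('a^2^2) set" where
  "scalars_GL2 A \<equiv> scalar_matrices <#>\<^bsub>GL2 UNIV\<^esub> carrier (GL2 A)"

definition Quinn :: "'a::field set \<Rightarrow> ('a^2^2) set monoid" where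
  "Quinn A = ((GL2 UNIV)\<lparr>carrier := normalizer_GL2 A\<rparr>) Mod (scalars_GL2 A)"

definition quinn_class :: "'a::field set \<Rightarrow> 'a^2^2 \<Rightarrow> ('a^2^2) set" where
  "quinn_class A g = scalars_GL2 A #>\<^bsub>GL2 UNIV\<^esub> g"

definition conj_subgroup :: "'a::field^2^2 \<Rightarrow> ('a^2^2) set \<Rightarrow> ('a^2^2) set" where
  "conj_subgroup g H = g <#\<^bsub>GL2 UNIV\<^esub> H #>\<^bsub>GL2 UNIV\<^esub> (inv\<^bsub>GL2 UNIV\<^esub> g)"

text \<open>Torsors: as usual, a transitive action is required to live on a nonempty set.\<close>

definition free_transitive_action :: "('g, 'm) monoid_scheme \<Rightarrow> 'e set \<Rightarrow> ('g \<Rightarrow> 'e \<Rightarrow> 'e) \<Rightarrow> bool" where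
  "free_transitive_action Q E \<phi> \<longleftrightarrow>
     transitive_action Q E \<phi> \<and> E \<noteq> {} \<and> (\<forall>x\<in>E. stabilizer Q \<phi> x = {\<one>\<^bsub>Q\<^esub>})"


section \<open>The Bruhat--Tits tree\<close>

definition lattice_span :: "'c::field set \<Rightarrow> ('c^2) set \<Rightarrow> ('c^2) set" where
  "lattice_span R S = {\<Sum>s\<in>S. c s *s s | c. \<forall>s\<in>S. c s \<in> R}"

definition is_lattice :: "'c::field set \<Rightarrow> ('c^2) set \<Rightarrow> bool" where
  "is_lattice R L \<longleftrightarrow> (\<exists>S. finite S \<and> L = lattice_span R S) \<and> vec.span L = UNIV"

definition homothety_class :: "('c::field^2) set \<Rightarrow> ('c^2) set set" where
  "homothety_class L = {(*s) a ` L | a. a \<noteq> 0}"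

text \<open>Neighbours have representatives with \<open>L / L'\<close> of length one, that is
  \<open>m L \<subset> L' \<subset> L\<close> strictly, \<open>m\<close> the maximal ideal of \<open>R\<close>. As \<open>m\<close> is principal for a
  discrete valuation ring, \<open>m L\<close> is just the set of products.\<close>

definition bt_adjacent :: "'c::field set \<Rightarrow> ('c^2) set set \<Rightarrow> ('c^2) set set \<Rightarrow> bool" where
  "bt_adjacent R u v \<longleftrightarrow>
     (\<exists>L\<in>u. \<exists>L'\<in>v. {a *s x | a x. a \<in> maximal_ideal R \<and> x \<in> L} \<subset> L' \<and> L' \<subset> L)"

text \<open>An undirected edge is represented by its two orientations.\<close>

definition bruhat_tits_tree ::
    "'c::field set \<Rightarrow> (('c^2) set set, ('c^2) set set \<times> ('c^2) set set) pre_digraph" where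
  "bruhat_tits_tree R =
     (let V = {homothety_class L | L. is_lattice R L}
      in \<lparr>verts = V, arcs = {(u, v). u \<in> V \<and> v \<in> V \<and> bt_adjacent R u v}, tail = fst, head = snd\<rparr>)"

definition bt_act :: "('a::field \<Rightarrow> 'c::field) \<Rightarrow> 'a^2^2 \<Rightarrow> ('c^2) set set \<Rightarrow> ('c^2) set set" where
  "bt_act \<iota> g v = (\<lambda>L. (*v) (map_matrix \<iota> g) ` L) ` v"

text \<open>The edges of the quotient graph are orbits of oriented edges, hence sets of pairs, so that
  the ends of an edge are obtained by projecting.\<close>

definition quotient_graph ::
    "('g, 'm) monoid_scheme \<Rightarrow> ('g \<Rightarrow> 'v \<Rightarrow> 'v) \<Rightarrow> ('v, 'v \<times> 'v) pre_digraph
      \<Rightarrow> ('v set, ('v \<times> 'v) set) pre_digraph" where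
  "quotient_graph G \<alpha> T =
     \<lparr>verts = orbits G (verts T) \<alpha>,
      arcs = orbits G (arcs T) (\<lambda>g. map_prod (\<alpha> g) (\<alpha> g)),
      tail = (`) fst, head = (`) snd\<rparr>"


section \<open>The two sets acted upon\<close>

definition conj_class :: "'a::field set \<Rightarrow> ('a^2^2) set \<Rightarrow> ('a^2^2) set set" where
  "conj_class A H = orbit (GL2 A) conj_subgroup H"

definition GL2_subgroups :: "'a::field set \<Rightarrow> 'a set \<Rightarrow> ('a^2^2) set set" where
  "GL2_subgroups F A = {H. subgroup H (GL2 A) \<and> (GL2 A)\<lparr>carrier := H\<rparr> \<cong> GL2 F}"

definition vertex_class ::
    "'a::field set \<Rightarrow> ('a \<Rightarrow> 'c::field) \<Rightarrow> ('c^2) set set \<Rightarrow> ('c^2) set set set" where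
  "vertex_class A \<iota> v = orbit (GL2 A) (bt_act \<iota>) v"

definition GL2_vertices ::
    "'a::field set \<Rightarrow> 'a set \<Rightarrow> ('a \<Rightarrow> 'c::field) \<Rightarrow> 'c set \<Rightarrow> ('c^2) set set set set" where
  "GL2_vertices F A \<iota> R =
     {w \<in> verts (quotient_graph (GL2 A) (bt_act \<iota>) (bruhat_tits_tree R)).
        \<forall>v\<in>w. (GL2 A)\<lparr>carrier := stabilizer (GL2 A) (bt_act \<iota>) v\<rparr> \<cong> GL2 F}"

end

theory Submission
  imports Defs
begin

text \<open>An embedding of \<open>GL\<^sub>2(F)\<close> into \<open>GL\<^sub>2(K)\<close> is conjugate to one with image \<open>GL\<^sub>2(F)\<close>:
  in characteristic \<open>p\<close> the upper unipotents have a common fixed vector \<open>w\<close>, and in the basis formed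
  by \<open>w\<close> and its image under the swap the embedding preserves unipotents, diagonal matrices and the
  swap; the diagonal entries are roots of unity, hence constants, and the relation
  \<open>U(b) L(-1/b) U(b) = diag(b, -1/b) S\<close> makes all other entries constant.
  If \<open>g GL\<^sub>2(F) g\<^sup>-\<^sup>1\<close> lies in \<open>M\<^sub>2(B)\<close>, conjugating matrix units shows that all products
  \<open>g\<^sub>i\<^sub>j g\<^sub>k\<^sub>l / det g\<close> lie in \<open>B\<close>. For \<open>B = A\<close> this condition is invariant under inversion and puts
  \<open>g\<close> into the normalizer of \<open>GL\<^sub>2(A)\<close>, which gives transitivity; for \<open>B = F\<close> it makes \<open>g\<close> a scalar
  multiple of an element of \<open>GL\<^sub>2(F)\<close>, which gives freeness.
  On the tree, \<open>GL\<^sub>2(F)\<close> is the stabilizer of the class of the standard lattice, because an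
  element integral at all places is constant, and this class is its only fixed vertex. Hence
  taking stabilizers identifies the two sets.\<close>

section \<open>Subrings and subfields\<close>


text \<open>The ring \<open>A\<close> is in general not principal, so an element \<open>g\<close> of
  the normalizer need not be a scalar times an element of \<open>GL2 A\<close>. The entries of
  \<open>g\<close> span a fractional ideal whose square is generated by \<open>det g\<close>, and
  the class of this ideal is the obstruction. The predicate \<open>products_in\<close> expresses
  this without ideals, as a condition on entries that can be read off from conjugates. Both torsors
  are instances of \<open>quotient_torsor\<close>, with the normalizer acting on subgroups or
  vertices before classes are formed. The vertices borrow freeness from the subgroups, since equal
  images have equal stabilizers; transitivity there rests on the uniqueness of the fixed vertex. Two
  difficulties shape the details. The characteristic may be 2, so no step divides by 2 or relies on
  diag(1, -1) being nontrivial. And a vertex determines its lattice only up to a scalar, which is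
  controlled by involutions or by \<open>det g\<close> being constant. Places have to be
  constructed: that an element without poles is constant comes from Zorn's lemma and the argument of
  Chevalley's extension theorem.\<close>

lemma is_subringD:
  assumes "is_subring R"
  shows "1 \<in> R" "0 \<in> R" "x \<in> R \<Longrightarrow> y \<in> R \<Longrightarrow> x - y \<in> R" "x \<in> R \<Longrightarrow> y \<in> R \<Longrightarrow> x * y \<in> R"
    "x \<in> R \<Longrightarrow> - x \<in> R" "x \<in> R \<Longrightarrow> y \<in> R \<Longrightarrow> x + y \<in> R"
proof -
  show 1: "1 \<in> R" and "x \<in> R \<Longrightarrow> y \<in> R \<Longrightarrow> x * y \<in> R"
    using assms unfolding is_subring_def by blast+
  show sub: "x \<in> R \<Longrightarrow> y \<in> R \<Longrightarrow> x - y \<in> R" for x y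
    using assms unfolding is_subring_def by blast
  show 0: "0 \<in> R"
    using sub[OF 1 1] by simp
  show neg: "x \<in> R \<Longrightarrow> - x \<in> R" for x
    using sub[OF 0] by simp
  show "x \<in> R \<Longrightarrow> y \<in> R \<Longrightarrow> x + y \<in> R"
    using sub[of x "- y"] neg by simp
qed

lemma is_subring_sum:
  assumes "is_subring R" "\<And>i. i \<in> I \<Longrightarrow> f i \<in> R"
  shows "sum f I \<in> R"
  using assms(2) by (induction I rule: infinite_finite_induct) (auto intro: is_subringD[OF assms(1)])

lemma is_subring_power: "is_subring R \<Longrightarrow> x \<in> R \<Longrightarrow> x ^ n \<in> R"
  by (induction n) (auto intro: is_subringD)

lemma is_subfieldD:
  assumes "is_subfield F"
  shows "is_subring F" "x \<in> F \<Longrightarrow> inverse x \<in> F" "x \<in> F \<Longrightarrow> y \<in> F \<Longrightarrow> x / y \<in> F"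
  using assms is_subringD(4)[of F] unfolding is_subfield_def divide_inverse by blast+

section \<open>Places separate the constants from the other elements\<close>

definition ring_adjoin :: "'a::field set \<Rightarrow> 'a \<Rightarrow> 'a set" where
  "ring_adjoin R z = {poly p z | p. \<forall>i. coeff p i \<in> R}"

lemma ring_adjoinI: "(\<And>i. coeff p i \<in> R) \<Longrightarrow> poly p z \<in> ring_adjoin R z"
  unfolding ring_adjoin_def by blast

lemma
  assumes "is_subring R"
  shows is_subring_ring_adjoin: "is_subring (ring_adjoin R z)"
    and subset_ring_adjoin: "R \<subseteq> ring_adjoin R z"
    and in_ring_adjoin: "z \<in> ring_adjoin R z"
proof -
  note R = is_subringD[OF assms]
  show sub: "R \<subseteq> ring_adjoin R z"
  proof
    fix a assume "a \<in> R"
    then have "coeff [:a:] i \<in> R" for i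
      using R(2) by (cases i) (auto simp: coeff_pCons)
    from ring_adjoinI[OF this, of z] show "a \<in> ring_adjoin R z" by simp
  qed
  have "coeff [:0, 1:] i \<in> R" for i
    using R(1,2) by (auto simp: coeff_pCons split: nat.split)
  from ring_adjoinI[OF this, of z] show "z \<in> ring_adjoin R z" by simp
  show "is_subring (ring_adjoin R z)"
    unfolding is_subring_def
  proof (intro conjI ballI)
    show "1 \<in> ring_adjoin R z" using sub R(1) by blast
    fix x y assume "x \<in> ring_adjoin R z" "y \<in> ring_adjoin R z"
    then obtain p q where pq: "x = poly p z" "y = poly q z" "\<And>i. coeff p i \<in> R" "\<And>i. coeff q i \<in> R"
      unfolding ring_adjoin_def by blast
    have "coeff (p - q) i \<in> R" for i using pq R(3) by simp
    from ring_adjoinI[OF this, of z] show "x - y \<in> ring_adjoin R z" using pq by simp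
    have "coeff (p * q) i \<in> R" for i
      using pq R(4) unfolding coeff_mult by (intro is_subring_sum[OF assms]) auto
    from ring_adjoinI[OF this, of z] show "x * y \<in> ring_adjoin R z" using pq by simp
  qed
qed

text \<open>Multiplying \<open>x = p(1/x)\<close> by the power of \<open>x\<close> with exponent
  \<open>degree p\<close> gives a monic equation for \<open>x\<close> over \<open>F\<close>: the
  reflected polynomial has degree at most \<open>degree p\<close>, so the top coefficient 1
  survives.\<close>

lemma not_algebraic_notin_ring_adjoin_inverse:
  assumes F: "is_subfield F" and x: "\<not> algebraic_over F x"
  shows "x \<notin> ring_adjoin F (inverse x)"
proof
  note R = is_subringD[OF is_subfieldD(1)[OF F]]
  assume "x \<in> ring_adjoin F (inverse x)"
  then obtain p where p: "poly p (inverse x) = x" "\<And>i. coeff p i \<in> F"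
    unfolding ring_adjoin_def by force
  have "x \<noteq> 0"
  proof
    assume "x = 0"
    then have "algebraic_over F x"
      unfolding algebraic_over_def using R(1,2)
      by (intro exI[of _ "[:0, 1:]"]) (auto simp: coeff_pCons split: nat.split)
    then show False using x by simp
  qed
  define r where "r = monom 1 (Suc (degree p)) - reflect_poly p"
  have "coeff r (Suc (degree p)) = 1"
    unfolding r_def by (simp add: coeff_reflect_poly)
  then have "r \<noteq> 0" by auto
  moreover have "coeff r i \<in> F" for i
    unfolding r_def by (auto simp: coeff_reflect_poly intro!: R p)
  moreover have "poly r x = 0"
    using \<open>x \<noteq> 0\<close> p(1) unfolding r_def by (simp add: poly_monom poly_reflect_poly_nz)
  ultimately show False
    using x unfolding algebraic_over_def by blast
qed

text \<open>Thus \<open>1/x\<close> lies in the Jacobson radical of \<open>R\<close>.\<close>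

lemma maximal_subring_avoiding_unit:
  assumes R: "is_subring R" "x \<notin> R" "inverse x \<in> R"
    and max: "\<And>R'. is_subring R' \<Longrightarrow> R \<subseteq> R' \<Longrightarrow> x \<notin> R' \<Longrightarrow> R' = R"
    and b: "b \<in> R"
  shows "inverse (1 - inverse x * b) \<in> R" "1 - inverse x * b \<noteq> 0"
proof -
  note r = is_subringD[OF R(1)]
  have x: "x \<noteq> 0" using R(2) r(2) by blast
  define e where "e = 1 - inverse x * b"
  have e0: "e \<noteq> 0"
  proof
    assume "e = 0"
    then have "b = x" unfolding e_def using x by (simp add: field_simps)
    then show False using b R(2) by simp
  qed
  then show "1 - inverse x * b \<noteq> 0" unfolding e_def .
  \<comment> \<open>All powers of \<open>e\<close> stay congruent to 1 modulo the multiples of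
    \<open>inverse x\<close> in \<open>R\<close>.\<close>
  have pow: "\<exists>c\<in>R. e ^ n = 1 - inverse x * c" for n
  proof (induction n)
    case 0
    show ?case using r(2) by (intro bexI[of _ 0]) auto
  next
    case (Suc n)
    then obtain c where c: "c \<in> R" "e ^ n = 1 - inverse x * c" by blast
    show ?case
    proof
      show "b + c - inverse x * b * c \<in> R" by (intro r(3,4,6) b c R(3))
      show "e ^ Suc n = 1 - inverse x * (b + c - inverse x * b * c)"
        unfolding power_Suc c(2) unfolding e_def by (simp add: algebra_simps)
    qed
  qed
  \<comment> \<open>If \<open>x = p(1/e)\<close>, multiply by
    \<open>e ^ degree p = 1 - inverse x * c\<close>: the right side becomes \<open>x - c\<close>,
    the left side lies in \<open>R\<close>, and so \<open>x\<close> would lie in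
    \<open>R\<close>.\<close>
  have "x \<notin> ring_adjoin R (inverse e)"
  proof
    assume "x \<in> ring_adjoin R (inverse e)"
    then obtain p where p: "poly p (inverse e) = x" "\<And>i. coeff p i \<in> R"
      unfolding ring_adjoin_def by force
    obtain c where c: "c \<in> R" "e ^ degree p = 1 - inverse x * c" using pow by blast
    have eR: "e \<in> R" unfolding e_def by (intro r(1,3,4) b R(3))
    have "poly (reflect_poly p) e = e ^ degree p * x"
      using e0 p(1) by (simp add: poly_reflect_poly_nz)
    moreover have "poly (reflect_poly p) e \<in> R"
      unfolding poly_altdef using p(2) r(2) eR
      by (intro is_subring_sum[OF R(1)] r(4) is_subring_power[OF R(1)]) (auto simp: coeff_reflect_poly)
    moreover have "e ^ degree p * x = x - c"
      using x unfolding c(2) by (simp add: algebra_simps)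
    ultimately have "x - c \<in> R" by simp
    then have "x - c + c \<in> R" using c(1) r(6) by blast
    then show False using R(2) by simp
  qed
  then have "ring_adjoin R (inverse e) = R"
    using max is_subring_ring_adjoin[OF R(1)] subset_ring_adjoin[OF R(1)] by blast
  then show "inverse (1 - inverse x * b) \<in> R"
    using in_ring_adjoin[OF R(1), of "inverse e"] unfolding e_def by simp
qed

text \<open>The descent step of Chevalley's extension theorem.\<close>

lemma degree_descent:
  assumes R: "is_subring R" "x \<notin> R" "inverse x \<in> R"
    and max: "\<And>R'. is_subring R' \<Longrightarrow> R \<subseteq> R' \<Longrightarrow> x \<notin> R' \<Longrightarrow> R' = R"
    and z: "z \<noteq> 0"
    and p: "\<And>i. coeff p i \<in> R" "poly p z = x"
    and q: "\<And>i. coeff q i \<in> R" "poly q (inverse z) = x"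
    and le: "degree q \<le> degree p"
  shows "\<exists>p'. (\<forall>i. coeff p' i \<in> R) \<and> poly p' z = x \<and> degree p' < degree p"
proof -
  note r = is_subringD[OF R(1)]
  have x: "x \<noteq> 0" using R(2) r(2) by blast
  define n where "n = degree p"
  \<comment> \<open>\<open>e\<close> is a unit of \<open>R\<close>, and \<open>x * e\<close> is what
    remains of \<open>q(1/z)\<close> without its constant term.\<close>
  define e where "e = 1 - inverse x * coeff q 0"
  have e: "inverse e \<in> R" "e \<noteq> 0"
    unfolding e_def using maximal_subring_avoiding_unit[OF R max q(1)] by auto
  \<comment> \<open>As \<open>x * e\<close> is a combination of negative powers of \<open>z\<close>,
    this choice turns \<open>c * z^n * (x * e)\<close> into the leading term of \<open>p\<close> at
    \<open>z\<close>. Expanded, it has the exponents \<open>n - j\<close> with \<open>j\<close> at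
    least 1, all natural numbers because \<open>degree q\<close> is at most \<open>n\<close>. So
    \<open>t\<close> replaces the leading term by lower ones.\<close>
  define c where "c = coeff p n * inverse e * inverse x"
  have c: "c \<in> R" unfolding c_def using r(4) p(1) e(1) R(3) by blast
  define t where "t = (\<Sum>j\<in>{1..degree q}. monom (c * coeff q j) (n - j))"
  define p' where "p' = p - monom (coeff p n) n + t"
  have n0: "n > 0"
  proof (rule ccontr)
    assume "\<not> n > 0"
    then obtain a where "p = [:a:]" unfolding n_def using degree_eq_zeroE by blast
    then show False using p(2) p(1)[of 0] R(2) by simp
  qed
  have "x = (\<Sum>j\<le>degree q. coeff q j * inverse z ^ j)"
    using q(2) by (simp add: poly_altdef)
  also have "\<dots> = coeff q 0 + (\<Sum>j\<in>{1..degree q}. coeff q j * inverse z ^ j)"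
    by (subst sum.atMost_shift) (simp add: sum.atLeast1_atMost_eq lessThan_Suc_atMost)
  finally have "x - coeff q 0 = (\<Sum>j\<in>{1..degree q}. coeff q j * inverse z ^ j)"
    by (simp add: algebra_simps)
  moreover have "x - coeff q 0 = x * e" unfolding e_def using x by (simp add: field_simps)
  ultimately have xe: "x * e = (\<Sum>j\<in>{1..degree q}. coeff q j * inverse z ^ j)" by simp
  have "poly t z = c * z ^ n * (\<Sum>j\<in>{1..degree q}. coeff q j * inverse z ^ j)"
    unfolding t_def poly_sum sum_distrib_left poly_monom
  proof (rule sum.cong[OF refl])
    fix j assume "j \<in> {1..degree q}"
    then have "j \<le> n" using le unfolding n_def by simp
    then show "c * coeff q j * z ^ (n - j) = c * z ^ n * (coeff q j * inverse z ^ j)"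
      using z by (simp add: power_diff field_simps)
  qed
  also have "\<dots> = coeff p n * z ^ n"
    unfolding xe[symmetric] c_def using x e(2) by (simp add: field_simps)
  finally have "poly p' z = x"
    unfolding p'_def using p(2) by (simp add: poly_monom)
  moreover have "coeff p' i \<in> R" for i
    unfolding p'_def t_def coeff_add coeff_diff coeff_sum coeff_monom
    using p(1) q(1) c r by (intro r(6) r(3) is_subring_sum[OF R(1)]) auto
  moreover have "degree p' < n"
  proof -
    have "coeff p' i = 0" if "i \<ge> n" for i
    proof -
      have "coeff t i = 0"
        unfolding t_def coeff_sum coeff_monom using that n0 by (intro sum.neutral) auto
      moreover have "coeff (p - monom (coeff p n) n) i = 0"
        using that by (cases "i = n") (auto simp: coeff_eq_0 n_def)
      ultimately show ?thesis unfolding p'_def by simp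
    qed
    then show ?thesis using n0 by (metis degree_0 leading_coeff_0_iff not_le)
  qed
  ultimately show ?thesis unfolding n_def by blast
qed

text \<open>If \<open>z\<close> and \<open>1/z\<close> are both missing from \<open>R\<close>,
  maximality forces \<open>x\<close> into both \<open>R[z]\<close> and \<open>R[1/z]\<close>. Write
  \<open>x\<close> in each with least possible degree; \<open>degree_descent\<close> then shortens
  the representation whose degree is not smaller than the other.\<close>

lemma maximal_subring_is_valuation_ring:
  assumes R: "is_subring R" "x \<notin> R" "inverse x \<in> R"
    and max: "\<And>R'. is_subring R' \<Longrightarrow> R \<subseteq> R' \<Longrightarrow> x \<notin> R' \<Longrightarrow> R' = R"
  shows "valuation_ring R"
proof -
  have "z \<in> R \<or> inverse z \<in> R" for z
  proof (rule ccontr)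
    assume neg: "\<not> (z \<in> R \<or> inverse z \<in> R)"
    then have z: "z \<noteq> 0" using is_subringD(2)[OF R(1)] by auto
    define D where "D w d \<longleftrightarrow> (\<exists>p. (\<forall>i. coeff p i \<in> R) \<and> poly p w = x \<and> degree p = d)" for w d
    have ex: "\<exists>d. D w d" if "w \<notin> R" for w
    proof -
      have "x \<in> ring_adjoin R w"
        using max[OF is_subring_ring_adjoin[OF R(1)] subset_ring_adjoin[OF R(1)]]
          in_ring_adjoin[OF R(1)] that by blast
      then show ?thesis unfolding ring_adjoin_def D_def by blast
    qed
    define m where "m w = (LEAST d. D w d)" for w
    have least: "D w (m w)" "\<And>d. D w d \<Longrightarrow> m w \<le> d" if "w \<notin> R" for w
      unfolding m_def using ex[OF that] by (auto intro: LeastI_ex Least_le)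
    have step: False if w: "w \<noteq> 0" "w \<notin> R" "inverse w \<notin> R" "m (inverse w) \<le> m w" for w
    proof -
      obtain p q where p: "\<And>i. coeff p i \<in> R" "poly p w = x" "degree p = m w"
        and q: "\<And>i. coeff q i \<in> R" "poly q (inverse w) = x" "degree q = m (inverse w)"
        using least(1)[OF w(2)] least(1)[OF w(3)] unfolding D_def by blast
      obtain p' where "\<forall>i. coeff p' i \<in> R" "poly p' w = x" "degree p' < degree p"
        using degree_descent[OF R max w(1) p(1,2) q(1,2)] p(3) q(3) w(4) by auto
      then show False using least(2)[OF w(2), of "degree p'"] p(3) unfolding D_def by auto
    qed
    show False
      using step[of z] step[of "inverse z"] neg z by (cases "m (inverse z) \<le> m z") auto
  qed
  then show ?thesis
    unfolding valuation_ring_def using R by blast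
qed

text \<open>Zorn's lemma applies to the subrings that contain \<open>F\<close> and
  \<open>1/x\<close> but not \<open>x\<close>. The family is nonempty because of
  \<open>F[1/x]\<close>, and its maximal members are valuation rings.\<close>

lemma ex_place_avoiding:
  assumes F: "is_subfield F" and x: "\<not> algebraic_over F x"
  shows "\<exists>Q. is_place F Q \<and> x \<notin> Q"
proof -
  note FR = is_subfieldD(1)[OF F]
  define S where "S = {R. is_subring R \<and> F \<subseteq> R \<and> inverse x \<in> R \<and> x \<notin> R}"
  have "ring_adjoin F (inverse x) \<in> S"
    unfolding S_def using is_subring_ring_adjoin[OF FR] subset_ring_adjoin[OF FR] in_ring_adjoin[OF FR]
      not_algebraic_notin_ring_adjoin_inverse[OF F x] by blast
  then have "S \<noteq> {}" by blast
  moreover have "\<Union>C \<in> S" if C: "C \<noteq> {}" "subset.chain S C" for C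
  proof -
    have CS: "\<And>R. R \<in> C \<Longrightarrow> R \<in> S" and tot: "\<And>R R'. R \<in> C \<Longrightarrow> R' \<in> C \<Longrightarrow> R \<subseteq> R' \<or> R' \<subseteq> R"
      using C(2) unfolding subset.chain_def by blast+
    have "is_subring (\<Union>C)"
      unfolding is_subring_def
    proof (intro conjI ballI)
      show "1 \<in> \<Union>C" using C(1) CS unfolding S_def is_subring_def by blast
      fix y z assume "y \<in> \<Union>C" "z \<in> \<Union>C"
      then obtain R where "R \<in> C" "y \<in> R" "z \<in> R" using tot by blast
      then show "y - z \<in> \<Union>C" "y * z \<in> \<Union>C"
        using CS[of R] is_subringD(3,4)[of R y z] unfolding S_def by blast+
    qed
    then show ?thesis using C(1) CS unfolding S_def by blast
  qed
  ultimately obtain Q where Q: "Q \<in> S" "\<And>R. R \<in> S \<Longrightarrow> Q \<subseteq> R \<Longrightarrow> R = Q"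
    using subset_Zorn_nonempty[of S] by metis
  have "valuation_ring Q"
    by (rule maximal_subring_is_valuation_ring[of Q x]) (use Q in \<open>auto simp: S_def\<close>)
  \<comment> \<open>The element \<open>inverse x\<close> of \<open>Q\<close> outside
    \<open>F\<close> makes the inclusion of \<open>F\<close> in \<open>Q\<close> strict, as
    \<open>is_place\<close> demands.\<close>
  moreover have "inverse x \<notin> F"
    using is_subfieldD(2)[OF F, of "inverse x"] Q(1) unfolding S_def by auto
  ultimately have "is_place F Q"
    unfolding is_place_def using Q(1) unfolding S_def by blast
  then show ?thesis using Q(1) unfolding S_def by blast
qed

section \<open>Elements integral outside the place, and their units\<close>

lemma is_subring_integral_outside: "is_subring (integral_outside F P)"
  unfolding is_subring_def integral_outside_def is_place_def valuation_ring_def by blast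

lemma subset_integral_outside: "F \<subseteq> integral_outside F P"
  unfolding integral_outside_def is_place_def by blast

lemma integral_everywhere:
  assumes "function_field F" "is_place F P" "x \<in> integral_outside F P" "x \<in> P"
  shows "x \<in> F"
proof (rule ccontr)
  assume "x \<notin> F"
  then obtain Q where "is_place F Q" "x \<notin> Q"
    using ex_place_avoiding assms(1) unfolding function_field_def by blast
  then show False using assms unfolding integral_outside_def by blast
qed

text \<open>The remaining place \<open>P\<close> contains \<open>x\<close> or its inverse, so one of
  the two is integral everywhere and hence constant; a field that contains one contains the
  other.\<close>

lemma integral_outside_units:
  assumes ff: "function_field F" "is_place F P"
    and x: "x \<in> integral_outside F P" "inverse x \<in> integral_outside F P"
  shows "x \<in> F"
proof -
  have F: "is_subfield F" using ff(1) unfolding function_field_def by blast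
  have "x \<in> P \<or> inverse x \<in> P" using ff(2) unfolding is_place_def valuation_ring_def by blast
  then show ?thesis
    using integral_everywhere[OF ff] x is_subfieldD(2)[OF F, of "inverse x"] by auto
qed


section \<open>Two-by-two matrices\<close>

definition mat2 :: "'a \<Rightarrow> 'a \<Rightarrow> 'a \<Rightarrow> 'a \<Rightarrow> 'a::zero^2^2" where
  "mat2 a b c d = vector [vector [a, b], vector [c, d]]"

lemma mat2_nth [simp]:
  "mat2 a b c d $ 1 $ 1 = a" "mat2 a b c d $ 1 $ 2 = b"
  "mat2 a b c d $ 2 $ 1 = c" "mat2 a b c d $ 2 $ 2 = d"
  unfolding mat2_def by simp_all

lemma mat2_eta: "mat2 (M $ 1 $ 1) (M $ 1 $ 2) (M $ 2 $ 1) (M $ 2 $ 2) = M"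
  by (simp add: vec_eq_iff forall_2)

lemma mat2_cases:
  obtains a b c d where "M = mat2 a b c d"
  using mat2_eta[of M] by metis

lemma mat2_eq_iff: "mat2 a b c d = mat2 a' b' c' d' \<longleftrightarrow> a = a' \<and> b = b' \<and> c = c' \<and> d = d'"
  by (metis mat2_nth)

lemma mat_eq_mat2: "mat c = mat2 c 0 0 c"
  by (simp add: vec_eq_iff forall_2 mat_def)

lemma mat2_mult:
  "mat2 a b c d ** mat2 a' b' c' d' =
    mat2 (a * a' + b * c') (a * b' + b * d') (c * a' + d * c') (c * b' + d * d')"
  for a :: "'a::semiring_1"
  by (simp add: vec_eq_iff forall_2 matrix_matrix_mult_def sum_2)

lemma det_mat2: "det (mat2 a b c d) = a * d - b * c" for a :: "'a::comm_ring_1"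
  by (simp add: det_2)

lemma mat2_mult_vec:
  "mat2 a b c d *v x = vector [a * x $ 1 + b * x $ 2, c * x $ 1 + d * x $ 2]"
  for a :: "'a::semiring_1"
  by (simp add: vec_eq_iff forall_2 matrix_vector_mult_def sum_2)

lemma matrix_inv_mult:
  fixes M :: "'a::field^'n^'n"
  assumes "det M \<noteq> 0"
  shows "M ** matrix_inv M = mat 1" "matrix_inv M ** M = mat 1"
proof -
  have "\<exists>N. M ** N = mat 1 \<and> N ** M = mat 1"
    using assms invertible_det_nz unfolding invertible_def by blast
  from someI_ex[OF this] show "M ** matrix_inv M = mat 1" "matrix_inv M ** M = mat 1"
    unfolding matrix_inv_def by auto
qed

lemma matrix_inv_eqI:
  fixes M :: "'a::field^'n^'n"
  assumes "M ** N = mat 1"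
  shows "matrix_inv M = N"
proof -
  have "det M * det N = 1" using assms by (metis det_I det_mul)
  then have "det M \<noteq> 0" by auto
  then show ?thesis
    by (metis assms matrix_inv_mult(2) matrix_mul_assoc matrix_mul_lid matrix_mul_rid)
qed

lemma det_matrix_inv: "det (matrix_inv M) = inverse (det M)" if "det M \<noteq> 0" for M :: "'a::field^'n^'n"
  using that by (metis det_I det_mul inverse_unique matrix_inv_mult(1))

lemma matrix_inv_matrix_inv: "matrix_inv (matrix_inv M) = M" if "det M \<noteq> 0" for M :: "'a::field^'n^'n"
  using that by (simp add: matrix_inv_eqI matrix_inv_mult)

lemma matrix_inv_matrix_mult:
  fixes M :: "'a::field^'n^'n"
  assumes "det M \<noteq> 0" "det N \<noteq> 0"
  shows "matrix_inv (M ** N) = matrix_inv N ** matrix_inv M"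
  by (rule matrix_inv_eqI) (metis assms matrix_inv_mult(1) matrix_mul_assoc matrix_mul_rid)

lemma matrix_inv_cancel:
  fixes M :: "'a::field^'n^'n"
  assumes "det M \<noteq> 0"
  shows "M ** (matrix_inv M ** N) = N" "matrix_inv M ** (M ** N) = N"
    "N ** M ** matrix_inv M = N" "N ** matrix_inv M ** M = N"
  using matrix_inv_mult[OF assms] by (metis matrix_mul_assoc matrix_mul_lid matrix_mul_rid)+

lemma matrix_inv_mat2:
  fixes a :: "'a::field"
  assumes "a * d - b * c \<noteq> 0"
  shows "matrix_inv (mat2 a b c d) =
    mat2 (d / (a * d - b * c)) (- b / (a * d - b * c)) (- c / (a * d - b * c)) (a / (a * d - b * c))"
proof (rule matrix_inv_eqI)
  define e where "e = a * d - b * c"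
  have "e \<noteq> 0" using assms e_def by simp
  then show "mat2 a b c d ** mat2 (d / (a * d - b * c)) (- b / (a * d - b * c))
      (- c / (a * d - b * c)) (a / (a * d - b * c)) = mat 1"
    unfolding mat2_mult mat_eq_mat2 mat2_eq_iff e_def[symmetric]
    by (simp add: divide_simps) (simp add: e_def algebra_simps)
qed

text \<open>Every entry of the conjugate is a signed sum of \<open>w\<close>, \<open>x\<close>,
  \<open>y\<close>, \<open>z\<close> with coefficients of the form (product of two
  entries)/determinant. The formula is read in both directions: from the coefficients to the
  conjugate in \<open>products_in_conj\<close>, and back in
  \<open>products_in_if_conj\<close>.\<close>

lemma conj_mat2:
  fixes a :: "'a::field"
  assumes "a * d - b * c \<noteq> 0"
  shows "mat2 a b c d ** mat2 w x y z ** matrix_inv (mat2 a b c d) =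
    (let e = a * d - b * c in
     mat2 (w * (a * d / e) - x * (a * c / e) + y * (b * d / e) - z * (b * c / e))
          (- w * (a * b / e) + x * (a * a / e) - y * (b * b / e) + z * (a * b / e))
          (w * (c * d / e) - x * (c * c / e) + y * (d * d / e) - z * (c * d / e))
          (- w * (b * c / e) + x * (a * c / e) - y * (b * d / e) + z * (a * d / e)))"
  unfolding matrix_inv_mat2[OF assms] mat2_mult mat2_eq_iff Let_def
  by (simp add: algebra_simps add_divide_distrib diff_divide_distrib)

lemma mat_mult_commute: "mat c ** M = M ** mat c" for M :: "'a::comm_semiring_1^2^2"
  by (cases M rule: mat2_cases) (simp add: mat_eq_mat2 mat2_mult mult.commute)

lemma matrices_over_mat2 [simp]:
  "mat2 a b c d \<in> matrices_over R \<longleftrightarrow> a \<in> R \<and> b \<in> R \<and> c \<in> R \<and> d \<in> R"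
  unfolding matrices_over_def by (auto simp: forall_2)

lemma matrices_over_mult:
  assumes "is_subring R" "M \<in> matrices_over R" "N \<in> matrices_over R"
  shows "M ** N \<in> matrices_over R"
  using assms(2,3) is_subringD(4,6)[OF assms(1)]
  by (cases M rule: mat2_cases; cases N rule: mat2_cases) (simp add: mat2_mult)

section \<open>The general linear groups\<close>

lemma GL2_simps [simp]:
  "x \<otimes>\<^bsub>GL2 R\<^esub> y = x ** y" "\<one>\<^bsub>GL2 R\<^esub> = mat 1"
  by (simp_all add: GL2_def)

lemma carrier_GL2_matrices: "M \<in> carrier (GL2 R) \<Longrightarrow> M \<in> matrices_over R"
  by (simp add: GL2_def)

lemma carrier_GL2_det: "M \<in> carrier (GL2 R) \<Longrightarrow> det M \<noteq> 0"
  using invertible_det_nz[of M] unfolding GL2_def invertible_def by auto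

lemma carrier_GL2_UNIV: "M \<in> carrier (GL2 UNIV) \<longleftrightarrow> det M \<noteq> 0"
  using invertible_det_nz[of M] unfolding GL2_def invertible_def matrices_over_def by auto

lemma carrier_GL2_iff:
  "M \<in> carrier (GL2 R) \<longleftrightarrow> det M \<noteq> 0 \<and> M \<in> matrices_over R \<and> matrix_inv M \<in> matrices_over R"
proof
  assume M: "M \<in> carrier (GL2 R)"
  then obtain N where "N \<in> matrices_over R" "M ** N = mat 1" unfolding GL2_def by auto
  then show "det M \<noteq> 0 \<and> M \<in> matrices_over R \<and> matrix_inv M \<in> matrices_over R"
    using M carrier_GL2_det[OF M] carrier_GL2_matrices[OF M] matrix_inv_eqI by metis
next
  assume "det M \<noteq> 0 \<and> M \<in> matrices_over R \<and> matrix_inv M \<in> matrices_over R"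
  then show "M \<in> carrier (GL2 R)"
    unfolding GL2_def using matrix_inv_mult[of M] by auto
qed

lemma carrier_GL2_inv: "M \<in> carrier (GL2 R) \<Longrightarrow> matrix_inv M \<in> carrier (GL2 R)"
  by (simp add: carrier_GL2_iff det_matrix_inv matrix_inv_matrix_inv)

lemma carrier_GL2_one: "is_subring R \<Longrightarrow> mat 1 \<in> carrier (GL2 R)"
  using is_subringD(1,2)[of R] matrix_inv_eqI[of "mat 1 :: 'a^2^2" "mat 1"]
  by (simp add: carrier_GL2_iff) (simp add: mat_eq_mat2)

lemma carrier_GL2_mult:
  "is_subring R \<Longrightarrow> M \<in> carrier (GL2 R) \<Longrightarrow> N \<in> carrier (GL2 R) \<Longrightarrow> M ** N \<in> carrier (GL2 R)"
  by (simp add: carrier_GL2_iff det_mul matrix_inv_matrix_mult matrices_over_mult)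

lemma carrier_GL2_mono: "R \<subseteq> S \<Longrightarrow> carrier (GL2 R) \<subseteq> carrier (GL2 S)"
  by (intro subsetI) (auto simp: carrier_GL2_iff[of _ R] carrier_GL2_iff[of _ S] matrices_over_def)

lemma is_subring_UNIV: "is_subring UNIV"
  by (simp add: is_subring_def)

lemma group_GL2: "is_subring R \<Longrightarrow> group (GL2 R)"
  by (rule groupI)
    (auto simp: carrier_GL2_mult carrier_GL2_one matrix_mul_assoc
      intro!: bexI[OF _ carrier_GL2_inv] matrix_inv_mult carrier_GL2_det)

lemmas group_GL2_UNIV = group_GL2[OF is_subring_UNIV]

lemma inv_GL2:
  assumes "det g \<noteq> 0"
  shows "inv\<^bsub>GL2 UNIV\<^esub> g = matrix_inv g"
  using assms group.inv_equality[OF group_GL2_UNIV, of "matrix_inv g" g]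
  by (simp add: carrier_GL2_UNIV det_matrix_inv matrix_inv_mult)

lemma conj_subgroup_eq:
  "det g \<noteq> 0 \<Longrightarrow> conj_subgroup g H = (\<lambda>h. g ** h ** matrix_inv g) ` H"
  unfolding conj_subgroup_def l_coset_def r_coset_def by (auto simp: inv_GL2)

lemma conj_subgroup_mult:
  assumes "det g \<noteq> 0" "det h \<noteq> 0"
  shows "conj_subgroup (g ** h) H = conj_subgroup g (conj_subgroup h H)"
  using assms by (simp add: conj_subgroup_eq det_mul matrix_inv_matrix_mult image_image matrix_mul_assoc)

lemma conj_subgroup_mat:
  assumes "c \<noteq> 0"
  shows "conj_subgroup (mat c) H = H"
proof -
  have d: "det (mat c :: 'a^2^2) \<noteq> 0" using assms by (simp add: mat_eq_mat2 det_mat2)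
  have "mat c ** h ** matrix_inv (mat c) = h" for h :: "'a^2^2"
    unfolding mat_mult_commute by (simp add: matrix_inv_cancel[OF d])
  then show ?thesis using d by (simp add: conj_subgroup_eq)
qed

lemma conj_subgroup_inv:
  assumes "det g \<noteq> 0"
  shows "conj_subgroup (matrix_inv g) (conj_subgroup g H) = H"
  using assms conj_subgroup_mat[of 1 H]
  by (simp add: conj_subgroup_mult[symmetric] det_matrix_inv matrix_inv_mult)

lemma normalizer_GL2_iff:
  "g \<in> normalizer_GL2 A \<longleftrightarrow> det g \<noteq> 0 \<and> conj_subgroup g (carrier (GL2 A)) = carrier (GL2 A)"
proof -
  have "carrier (GL2 A) \<subseteq> carrier (GL2 UNIV)"
    using carrier_GL2_mono by blast
  then show ?thesis
    unfolding normalizer_def stabilizer_def conj_subgroup_def by (auto simp: carrier_GL2_UNIV)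
qed

lemma carrier_GL2_subfield:
  assumes F: "is_subfield F" and M: "M \<in> matrices_over F" "det M \<noteq> 0"
  shows "M \<in> carrier (GL2 F)"
proof (cases M rule: mat2_cases)
  case (1 a b c d)
  note r = is_subringD[OF is_subfieldD(1)[OF F]]
  have "a \<in> F" "b \<in> F" "c \<in> F" "d \<in> F" "a * d - b * c \<noteq> 0"
    using M unfolding 1 det_mat2 by simp_all
  then show ?thesis
    unfolding carrier_GL2_iff 1 det_mat2
    by (auto simp: matrix_inv_mat2 intro!: r is_subfieldD(3)[OF F])
qed

lemma finite_carrier_GL2:
  assumes "finite F"
  shows "finite (carrier (GL2 F))"
proof (rule finite_subset)
  show "carrier (GL2 F) \<subseteq> (\<lambda>(a, b, c, d). mat2 a b c d) ` (F \<times> F \<times> F \<times> F)"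
  proof
    fix M assume M: "M \<in> carrier (GL2 F)"
    obtain a b c d where abcd: "M = mat2 a b c d" by (rule mat2_cases)
    then have "(a, b, c, d) \<in> F \<times> F \<times> F \<times> F"
      using carrier_GL2_matrices[OF M] by simp
    from imageI[OF this, of "\<lambda>(a, b, c, d). mat2 a b c d"]
    show "M \<in> (\<lambda>(a, b, c, d). mat2 a b c d) ` (F \<times> F \<times> F \<times> F)"
      unfolding abcd by simp
  qed
qed (use assms in auto)

section \<open>The normalizer of a general linear group\<close>

text \<open>For a subring \<open>R\<close> and invertible \<open>g\<close>, let J be the
  \<open>R\<close>-module spanned by the entries. The condition says that J squared equals
  \<open>R\<close> times \<open>det g\<close>, since \<open>det g\<close> itself lies in J squared.
  It is unaffected by scaling \<open>g\<close>.\<close>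

definition products_in :: "'a::field set \<Rightarrow> 'a^2^2 \<Rightarrow> bool" where
  "products_in R g \<longleftrightarrow> (\<forall>i j k l. g $ i $ j * g $ k $ l / det g \<in> R)"

lemma products_in_mat2:
  "products_in R (mat2 a b c d) \<longleftrightarrow> (\<forall>x\<in>{a,b,c,d}. \<forall>y\<in>{a,b,c,d}. x * y / (a * d - b * c) \<in> R)"
  unfolding products_in_def forall_2 det_mat2 by auto

text \<open>The inverse has the entries of \<open>g\<close> up to order, sign and the factor
  \<open>1/e\<close>, and determinant \<open>1/e\<close>, where \<open>e = det g\<close>. Hence its
  quotients (product)/(determinant) are those of \<open>g\<close> up to sign.\<close>

lemma products_in_inv:
  assumes R: "is_subring R" and g: "det g \<noteq> 0" "products_in R g"
  shows "products_in R (matrix_inv g)"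
proof (cases g rule: mat2_cases)
  case (1 a b c d)
  define e where "e = a * d - b * c"
  have e: "e \<noteq> 0" using g(1) unfolding 1 det_mat2 e_def .
  have p: "\<And>x y. x \<in> {a,b,c,d} \<Longrightarrow> y \<in> {a,b,c,d} \<Longrightarrow> x * y / e \<in> R"
    using g(2) unfolding 1 products_in_mat2 e_def by blast
  have inv: "matrix_inv g = mat2 (d / e) (- b / e) (- c / e) (a / e)"
    unfolding 1 e_def using e by (intro matrix_inv_mat2) (simp add: e_def)
  have "d / e * (a / e) - (- b / e) * (- c / e) = (a * d - b * c) / e\<^sup>2"
    by (simp add: power2_eq_square diff_divide_distrib mult.commute)
  also have "\<dots> = 1 / e" using e by (simp add: e_def[symmetric] power2_eq_square)
  finally have D: "d / e * (a / e) - (- b / e) * (- c / e) = 1 / e" .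
  have "x * y / (1 / e) \<in> R" if xy: "x \<in> {d / e, - b / e, - c / e, a / e}" "y \<in> {d / e, - b / e, - c / e, a / e}" for x y
  proof -
    obtain x' y' where x': "x' \<in> {a,b,c,d}" "x = x' / e \<or> x = - (x' / e)"
      and y': "y' \<in> {a,b,c,d}" "y = y' / e \<or> y = - (y' / e)"
      using xy by auto
    then have "x * y / (1 / e) = x' * y' / e \<or> x * y / (1 / e) = - (x' * y' / e)"
      using e by auto
    then show ?thesis using p[OF x'(1) y'(1)] is_subringD(5)[OF R] by metis
  qed
  then show ?thesis
    unfolding inv products_in_mat2 D by blast
qed

lemma products_in_conj:
  assumes R: "is_subring R" and g: "det g \<noteq> 0" "products_in R g" and M: "M \<in> matrices_over R"
  shows "g ** M ** matrix_inv g \<in> matrices_over R"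
proof (cases g rule: mat2_cases; cases M rule: mat2_cases)
  fix a b c d w x y z assume gM: "g = mat2 a b c d" "M = mat2 w x y z"
  define e where "e = a * d - b * c"
  have e: "a * d - b * c \<noteq> 0" using g(1) unfolding gM det_mat2 .
  have p: "\<And>x y. x \<in> {a,b,c,d} \<Longrightarrow> y \<in> {a,b,c,d} \<Longrightarrow> x * y / e \<in> R"
    using g(2) unfolding gM products_in_mat2 e_def by blast
  have m: "w \<in> R" "x \<in> R" "y \<in> R" "z \<in> R" using M unfolding gM by simp_all
  note r = is_subringD[OF R]
  show ?thesis
    unfolding gM conj_mat2[OF e] Let_def matrices_over_mat2 e_def[symmetric]
    by (intro conjI r(3,4,5,6) m p) simp_all
qed

lemma conj_carrier_GL2_subset:
  assumes R: "is_subring R" and g: "det g \<noteq> 0" "products_in R g"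
  shows "conj_subgroup g (carrier (GL2 R)) \<subseteq> carrier (GL2 R)"
proof
  fix M assume "M \<in> conj_subgroup g (carrier (GL2 R))"
  then obtain h where h: "h \<in> carrier (GL2 R)" "M = g ** h ** matrix_inv g"
    using g(1) by (auto simp: conj_subgroup_eq)
  have "matrix_inv M = g ** matrix_inv h ** matrix_inv g"
    unfolding h(2) using g(1) carrier_GL2_det[OF h(1)]
    by (simp add: matrix_inv_matrix_mult det_mul det_matrix_inv matrix_inv_matrix_inv matrix_mul_assoc)
  then show "M \<in> carrier (GL2 R)"
    using h products_in_conj[OF R g] g(1)
    by (simp add: carrier_GL2_iff det_mul det_matrix_inv)
qed

text \<open>Conjugation by \<open>g\<close> maps the group into itself, and so does conjugation by
  \<open>matrix_inv g\<close>, because the condition passes to inverses; the second inclusion gives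
  equality in the first.\<close>

lemma products_in_normalizer:
  assumes R: "is_subring R" and g: "det g \<noteq> 0" "products_in R g"
  shows "g \<in> normalizer_GL2 R"
proof -
  have "carrier (GL2 R) = conj_subgroup g (conj_subgroup (matrix_inv g) (carrier (GL2 R)))"
    using conj_subgroup_inv[of "matrix_inv g"] g(1) by (simp add: det_matrix_inv matrix_inv_matrix_inv)
  also have "\<dots> \<subseteq> conj_subgroup g (carrier (GL2 R))"
    using conj_carrier_GL2_subset[OF R _ products_in_inv[OF R g]] g(1)
    by (auto simp: conj_subgroup_eq[OF g(1)] det_matrix_inv)
  finally show ?thesis
    using conj_carrier_GL2_subset[OF R g] g(1) unfolding normalizer_GL2_iff by blast
qed

text \<open>The matrix units are differences of elements of \<open>GL\<^sub>2(F)\<close>, and conjugating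
  them by \<open>g\<close> yields all products of two entries of \<open>g\<close>, divided by the determinant.\<close>

lemma products_in_if_conj:
  assumes F: "is_subring F" and B: "is_subring B" and g: "det g \<noteq> 0"
    and conj: "\<And>h. h \<in> carrier (GL2 F) \<Longrightarrow> g ** h ** matrix_inv g \<in> matrices_over B"
  shows "products_in B g"
proof (cases g rule: mat2_cases)
  case (1 a b c d)
  define e where "e = a * d - b * c"
  have e: "a * d - b * c \<noteq> 0" using g unfolding 1 det_mat2 .
  note f = is_subringD[OF F] and r = is_subringD[OF B]
  \<comment> \<open>Matrices with entries 0, 1 and determinant 1 or -1 lie in \<open>GL2\<close> of
    every subring.\<close>
  define adm where "adm w x y z \<longleftrightarrow> {w, x, y, z} \<subseteq> {0, 1} \<and> (w * z - x * y = 1 \<or> w * z - x * y = - 1)"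
    for w x y z :: 'a
  have mem: "mat2 w x y z \<in> carrier (GL2 F)" if "adm w x y z" for w x y z
  proof -
    have m: "w \<in> F" "x \<in> F" "y \<in> F" "z \<in> F" using that f unfolding adm_def by auto
    then have "- x \<in> F" "- y \<in> F" "- w \<in> F" "- z \<in> F" using f(5) by auto
    moreover have "w * z - x * y = 1 \<or> w * z - x * y = - 1" using that unfolding adm_def by simp
    ultimately show ?thesis
      using m unfolding carrier_GL2_iff det_mat2 by (elim disjE) (simp_all add: matrix_inv_mat2)
  qed
  note C = conj[unfolded 1, OF mem, unfolded conj_mat2[OF e] Let_def matrices_over_mat2, folded e_def]
  note C11 = conjunct1[OF C] and C12 = conjunct1[OF conjunct2[OF C]]
    and C21 = conjunct1[OF conjunct2[OF conjunct2[OF C]]]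
    and C22 = conjunct2[OF conjunct2[OF conjunct2[OF C]]]
  have adm: "adm 1 0 0 1" "adm 1 1 0 1" "adm 1 0 1 1" "adm 0 1 1 0" "adm 1 1 1 0"
    unfolding adm_def by simp_all
  \<comment> \<open>Differences of the five matrices are the matrix units E12 (second minus first),
    E21 (third minus first) and E11 (fifth minus fourth). Conjugating E12 exhibits
    \<open>a * a\<close>, \<open>a * c\<close>, \<open>c * c\<close>; E21 exhibits
    \<open>b * b\<close>, \<open>b * d\<close>, \<open>d * d\<close>; E11 exhibits
    \<open>a * b\<close>, \<open>a * d\<close>, \<open>b * c\<close>, \<open>c * d\<close>, each
    divided by \<open>e\<close> and up to sign.\<close>
  have "a * a / e \<in> B" using r(3)[OF C12[OF adm(2)] C12[OF adm(1)]] by simp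
  moreover have "a * b / e \<in> B" using r(3)[OF C12[OF adm(4)] C12[OF adm(5)]] by simp
  moreover have "a * c / e \<in> B" using r(3)[OF C11[OF adm(1)] C11[OF adm(2)]] by simp
  moreover have "a * d / e \<in> B" using r(3)[OF C11[OF adm(5)] C11[OF adm(4)]] by simp
  moreover have "b * b / e \<in> B" using r(3)[OF C12[OF adm(1)] C12[OF adm(3)]] by simp
  moreover have "b * c / e \<in> B" using r(3)[OF C22[OF adm(4)] C22[OF adm(5)]] by simp
  moreover have "b * d / e \<in> B" using r(3)[OF C11[OF adm(3)] C11[OF adm(1)]] by simp
  moreover have "c * c / e \<in> B" using r(3)[OF C21[OF adm(1)] C21[OF adm(2)]] by simp
  moreover have "c * d / e \<in> B" using r(3)[OF C21[OF adm(5)] C21[OF adm(4)]] by simp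
  moreover have "d * d / e \<in> B" using r(3)[OF C21[OF adm(3)] C21[OF adm(1)]] by simp
  ultimately show ?thesis
    unfolding 1 products_in_mat2 e_def[symmetric] by (auto simp: mult.commute)
qed

text \<open>The ratio of two entries is a quotient of two elements of the form
  (product)/(determinant). Over a field such ratios stay in \<open>F\<close>, so any nonzero entry
  can serve as the scalar factor.\<close>

lemma products_in_subfield:
  assumes F: "is_subfield F" and g: "det g \<noteq> 0" "products_in F g"
  shows "\<exists>c\<noteq>0. \<exists>h\<in>carrier (GL2 F). g = mat c ** h"
proof -
  obtain i j where x: "g $ i $ j \<noteq> 0"
  proof (rule ccontr)
    assume "\<not> thesis"
    then have "g $ i $ j = 0" for i j using that by blast
    then have "det g = 0" by (simp add: det_2)
    then show False using g(1) by simp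
  qed
  define x where "x = g $ i $ j"
  define h where "h = mat2 (g $ 1 $ 1 / x) (g $ 1 $ 2 / x) (g $ 2 $ 1 / x) (g $ 2 $ 2 / x)"
  have "mat x ** h = mat2 (g $ 1 $ 1) (g $ 1 $ 2) (g $ 2 $ 1) (g $ 2 $ 2)"
    using x unfolding h_def mat_eq_mat2 mat2_mult by (simp add: x_def)
  then have gh: "g = mat x ** h" unfolding mat2_eta by simp
  have "g $ k $ l / x \<in> F" for k l
  proof -
    have "g $ k $ l / x = (g $ k $ l * x / det g) / (x * x / det g)"
      using x g(1) unfolding x_def by simp
    then show ?thesis
      using g(2) is_subfieldD(3)[OF F] unfolding products_in_def x_def by metis
  qed
  then have "h \<in> matrices_over F" unfolding h_def by simp
  moreover have "det h \<noteq> 0" using g(1) unfolding gh det_mul by auto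
  ultimately show ?thesis
    using carrier_GL2_subfield[OF F] gh x unfolding x_def by blast
qed


section \<open>Embeddings of \<open>GL\<^sub>2(F)\<close> into \<open>GL\<^sub>2(K)\<close>\<close>

text \<open>Two powers coincide by pigeonhole. This is how diagonal entries of images of the finite
  group \<open>GL2 F\<close> become constants.\<close>

lemma algebraic_over_if_powers_finite:
  fixes x :: "'a::field"
  assumes F: "is_subring F" and X: "finite X" "\<And>n. x ^ n \<in> X"
  shows "algebraic_over F x"
proof -
  have "\<not> inj (\<lambda>n. x ^ n)"
    using X finite_subset[of "range (\<lambda>n. x ^ n)" X] infinite_iff_countable_subset
      range_inj_infinite[of "\<lambda>n. x ^ n"] by blast
  then obtain i j where ij: "i \<noteq> j" "x ^ i = x ^ j" unfolding inj_on_def by blast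
  define p where "p = monom (1::'a) i - monom 1 j"
  have "coeff p i = 1" unfolding p_def using ij(1) by simp
  then have "p \<noteq> 0" by auto
  moreover have "poly p x = 0" unfolding p_def using ij(2) by (simp add: poly_monom)
  moreover have "coeff p k \<in> F" for k
    unfolding p_def coeff_diff coeff_monom using is_subringD(1,2)[OF F] is_subringD(3)[OF F] by auto
  ultimately show ?thesis unfolding algebraic_over_def by blast
qed

section \<open>Additive groups and unipotent matrices in characteristic p\<close>

lemma prime_CHAR_if_finite_subring:
  assumes "is_subring (F :: 'a::field set)" "finite F"
  shows "prime CHAR('a)"
proof -
  have "of_nat n \<in> F" for n
    by (induction n) (auto intro: is_subringD[OF assms(1)])
  then have "\<not> inj (of_nat :: nat \<Rightarrow> 'a)"
    using assms(2) range_inj_infinite[of "of_nat :: nat \<Rightarrow> 'a"] finite_subset[of "range (of_nat :: nat \<Rightarrow> 'a)" F]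
    by blast
  then obtain i j where "i < j" "of_nat i = (of_nat j :: 'a)"
    unfolding inj_on_def by (metis linorder_neqE_nat)
  then have "of_nat (j - i) = (0 :: 'a)" "j - i > 0" by (simp_all add: of_nat_diff)
  then have "CHAR('a) > 0" unfolding CHAR_pos_iff by blast
  then show ?thesis by (rule prime_CHAR_semidom)
qed

lemma diff_power_prime_CHAR:
  fixes x y :: "'a::comm_ring_1"
  assumes "prime CHAR('a)"
  shows "(x - y) ^ CHAR('a) = x ^ CHAR('a) - y ^ CHAR('a)"
  using freshmans_dream[OF assms refl, of x "- y"] minus_power_prime_CHAR[OF refl assms, of y] by simp

lemma power_CHAR_eq_1:
  fixes x :: "'a::field"
  assumes "prime CHAR('a)" "x ^ CHAR('a) = 1"
  shows "x = 1"
  using diff_power_prime_CHAR[OF assms(1), of x 1] assms(2) by simp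

text \<open>With p the characteristic, \<open>h b ^ p = h (p * b) = h 0 = 1\<close>, and 1 is the
  only p-th root of unity in characteristic p. It is applied to determinants and to diagonal entries
  of the images of unipotents.\<close>

lemma character_of_additive_group_trivial:
  fixes h :: "'a::field \<Rightarrow> 'a"
  assumes F: "is_subring F" and p: "prime CHAR('a)"
    and h: "\<And>b c. b \<in> F \<Longrightarrow> c \<in> F \<Longrightarrow> h (b + c) = h b * h c" "h 0 = 1" and b: "b \<in> F"
  shows "h b = 1"
proof -
  have "of_nat n * b \<in> F \<and> h (of_nat n * b) = h b ^ n" for n
    by (induction n) (auto simp: algebra_simps h b intro: is_subringD[OF F])
  from this[of "CHAR('a)"] have "h b ^ CHAR('a) = 1"
    using h(2) by simp
  then show ?thesis by (rule power_CHAR_eq_1[OF p])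
qed

text \<open>This is \<open>p(M)\<close> applied to \<open>v\<close>, by Horner's scheme. The
  binomial identity in characteristic p needs a commutative ring; it is proved for polynomials and
  carried to matrices by this evaluation.\<close>

definition vec_eval :: "'a::field^2^2 \<Rightarrow> 'a^2 \<Rightarrow> 'a poly \<Rightarrow> 'a^2" where
  "vec_eval M v p = fold_coeffs (\<lambda>a w. a *s v + M *v w) p 0"

lemma vec_eval_0 [simp]: "vec_eval M v 0 = 0"
  by (simp add: vec_eval_def)

lemma vec_eval_pCons [simp]: "vec_eval M v (pCons a p) = a *s v + M *v vec_eval M v p"
  by (cases "p = 0 \<and> a = 0") (auto simp: vec_eval_def)

lemma vec_eval_1 [simp]: "vec_eval M v 1 = v"
  using vec_eval_pCons[of M v 1 0] unfolding pCons_one by simp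

lemma vec_eval_add: "vec_eval M v (p + q) = vec_eval M v p + vec_eval M v q"
  by (induction p q rule: poly_induct2) (simp_all add: matrix_vector_right_distrib vec.scale_left_distrib algebra_simps)

lemma vec_eval_diff: "vec_eval M v (p - q) = vec_eval M v p - vec_eval M v q"
  using vec_eval_add[of M v "p - q" q] by simp

lemma vec_eval_monom: "vec_eval M v (monom 1 n) = ((*v) M ^^ n) v"
  by (induction n) (simp_all add: monom_Suc)

text \<open>The polynomial identity \<open>(X - 1)^p = X^p - 1\<close>, evaluated at \<open>M\<close>, shows that
  \<open>M - 1\<close> is nilpotent.\<close>

lemma ex_fixed_vector:
  fixes M :: "'a::field^2^2"
  assumes p: "prime CHAR('a)" and M: "\<And>v. ((*v) M ^^ CHAR('a)) v = v"
  shows "\<exists>w. w \<noteq> 0 \<and> M *v w = w"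
proof -
  define f where "f w = M *v w - w" for w
  have ev: "vec_eval M v ([:-1, 1:] ^ n) = (f ^^ n) v" for v n
  proof (induction n)
    case (Suc n)
    have "[:-1, 1 :: 'a:] ^ Suc n = pCons 0 ([:-1, 1:] ^ n) - [:-1, 1:] ^ n"
      by (simp add: smult_minus_left)
    then show ?case using Suc by (simp add: f_def vec_eval_diff)
  qed simp
  have "[:-1, 1:] = monom 1 1 - (1 :: 'a poly)"
    by (simp add: poly_eq_iff coeff_pCons split: nat.split)
  then have "([:-1, 1:] :: 'a poly) ^ CHAR('a) = monom 1 (CHAR('a)) - monom 1 0"
    using diff_power_prime_CHAR[of "monom 1 1 :: 'a poly" 1] p by (simp add: monom_power)
  then have nil: "(f ^^ CHAR('a)) v = 0" for v
    using ev[of v "CHAR('a)"] M by (simp add: vec_eval_diff vec_eval_monom)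
  define v where "v = (axis 1 1 :: 'a^2)"
  \<comment> \<open>The last nonzero iterate of the nilpotent \<open>f = M - 1\<close> on
    \<open>v\<close> is killed by \<open>f\<close>, so \<open>M\<close> fixes it.\<close>
  define k where "k = (LEAST k. (f ^^ k) v = 0)"
  have k: "(f ^^ k) v = 0" unfolding k_def by (rule LeastI) (rule nil)
  have "k \<noteq> 0" using k by (intro notI) (simp add: v_def)
  then obtain m where m: "k = Suc m" by (cases k) auto
  then have "(f ^^ m) v \<noteq> 0" using not_less_Least[of m "\<lambda>k. (f ^^ k) v = 0"] unfolding k_def by auto
  moreover have "M *v ((f ^^ m) v) = (f ^^ m) v" using k unfolding m by (simp add: f_def)
  ultimately show ?thesis by blast
qed

section \<open>Normal form of an embedding of \<open>GL2 F\<close>\<close>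

definition GL2_embedding :: "'a::field set \<Rightarrow> ('a^2^2 \<Rightarrow> 'a^2^2) \<Rightarrow> bool" where
  "GL2_embedding F \<theta> \<longleftrightarrow>
     (\<forall>M\<in>carrier (GL2 F). det (\<theta> M) \<noteq> 0) \<and> inj_on \<theta> (carrier (GL2 F)) \<and>
     (\<forall>M\<in>carrier (GL2 F). \<forall>N\<in>carrier (GL2 F). \<theta> (M ** N) = \<theta> M ** \<theta> N)"

lemma GL2_embeddingD:
  assumes "GL2_embedding F \<theta>"
  shows "M \<in> carrier (GL2 F) \<Longrightarrow> det (\<theta> M) \<noteq> 0" "inj_on \<theta> (carrier (GL2 F))"
    "M \<in> carrier (GL2 F) \<Longrightarrow> N \<in> carrier (GL2 F) \<Longrightarrow> \<theta> (M ** N) = \<theta> M ** \<theta> N"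
  using assms unfolding GL2_embedding_def by blast+

lemma GL2_embedding_one:
  assumes F: "is_subring F" and \<theta>: "GL2_embedding F \<theta>"
  shows "\<theta> (mat 1) = mat 1"
proof -
  have "\<theta> (mat 1) ** \<theta> (mat 1) = \<theta> (mat 1)"
    using GL2_embeddingD(3)[OF \<theta>, of "mat 1" "mat 1"] carrier_GL2_one[OF F] by simp
  then show ?thesis
    using matrix_inv_cancel(2)[OF GL2_embeddingD(1)[OF \<theta> carrier_GL2_one[OF F]], of "\<theta> (mat 1)"]
      matrix_inv_mult(2)[OF GL2_embeddingD(1)[OF \<theta> carrier_GL2_one[OF F]]] by simp
qed

lemma GL2_embedding_conj:
  assumes \<theta>: "GL2_embedding F \<theta>" and P: "det P \<noteq> 0"
  shows "GL2_embedding F (\<lambda>M. matrix_inv P ** \<theta> M ** P)"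
  unfolding GL2_embedding_def
proof (intro conjI ballI)
  show "det (matrix_inv P ** \<theta> M ** P) \<noteq> 0" if "M \<in> carrier (GL2 F)" for M
    using GL2_embeddingD(1)[OF \<theta> that] P by (simp add: det_mul det_matrix_inv)
  have "P ** (matrix_inv P ** N ** P) ** matrix_inv P = N" for N :: "'a^2^2"
    by (metis matrix_mul_assoc matrix_inv_cancel(1,3)[OF P])
  then have inj: "N = N'" if "matrix_inv P ** N ** P = matrix_inv P ** N' ** P" for N N' :: "'a^2^2"
    using that by metis
  show "inj_on (\<lambda>M. matrix_inv P ** \<theta> M ** P) (carrier (GL2 F))"
    using GL2_embeddingD(2)[OF \<theta>] inj unfolding inj_on_def by blast
  show "matrix_inv P ** \<theta> (M ** N) ** P = (matrix_inv P ** \<theta> M ** P) ** (matrix_inv P ** \<theta> N ** P)"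
    if "M \<in> carrier (GL2 F)" "N \<in> carrier (GL2 F)" for M N
    unfolding GL2_embeddingD(3)[OF \<theta> that]
    by (metis matrix_mul_assoc matrix_inv_cancel(1)[OF P])
qed

lemma mat2_in_GL2:
  assumes F: "is_subfield F" and "{a, b, c, d} \<subseteq> F" "a * d - b * c \<noteq> 0"
  shows "mat2 a b c d \<in> carrier (GL2 F)"
  by (rule carrier_GL2_subfield[OF F]) (use assms in \<open>auto simp: det_mat2\<close>)

text \<open>A fixed vector of the image of U(1) makes that image upper unipotent, and injectivity
  makes it nontrivial. All other U(b) commute with U(1), so their images have a single eigenvalue on
  the diagonal, which depends multiplicatively on \<open>b\<close> and is therefore 1.\<close>

lemma embedding_unipotents_triangular:
  fixes F :: "'a::field set"
  assumes F: "is_subfield F" "finite F" and \<theta>: "GL2_embedding F \<theta>"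
  shows "\<exists>P. det P \<noteq> 0 \<and> (\<forall>b\<in>F. \<exists>\<beta>. matrix_inv P ** \<theta> (mat2 1 b 0 1) ** P = mat2 1 \<beta> 0 1)"
proof -
  note FR = is_subfieldD(1)[OF F(1)]
  note f = is_subringD[OF FR]
  have p: "prime CHAR('a)" using prime_CHAR_if_finite_subring[OF FR F(2)] .
  have U: "mat2 1 b 0 1 \<in> carrier (GL2 F)" if "b \<in> F" for b
    using f(1,2) that by (intro mat2_in_GL2[OF F(1)]) auto
  have add: "\<theta> (mat2 1 (b + c) 0 1) = \<theta> (mat2 1 b 0 1) ** \<theta> (mat2 1 c 0 1)" if "b \<in> F" "c \<in> F" for b c
    using GL2_embeddingD(3)[OF \<theta> U[OF that(1)] U[OF that(2)]] by (simp add: mat2_mult add.commute)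
  have one: "\<theta> (mat2 1 0 0 1) = mat 1" using GL2_embedding_one[OF FR \<theta>] by (simp add: mat_eq_mat2)
  have det1: "det (\<theta> (mat2 1 b 0 1)) = 1" if "b \<in> F" for b
    by (rule character_of_additive_group_trivial[OF FR p _ _ that]) (simp_all add: add det_mul one)
  have "((*v) (\<theta> (mat2 1 1 0 1)) ^^ n) v = \<theta> (mat2 1 (of_nat n) 0 1) *v v \<and> of_nat n \<in> F" for n v
    by (induction n) (simp_all add: one add f matrix_vector_mul_assoc)
  \<comment> \<open>The n-th power of U(1) is U(n), so its p-th power is U(0), the identity.\<close>
  from this[of "CHAR('a)"] obtain w where w: "w \<noteq> 0" "\<theta> (mat2 1 1 0 1) *v w = w"
    using ex_fixed_vector[OF p, of "\<theta> (mat2 1 1 0 1)"] by (auto simp: one)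
  \<comment> \<open>The first column is \<open>w\<close>; the second is the standard basis vector
    that keeps \<open>P\<close> invertible.\<close>
  define P where "P = (if w $ 1 \<noteq> 0 then mat2 (w $ 1) 0 (w $ 2) 1 else mat2 (w $ 1) 1 (w $ 2) 0)"
  have "w $ 1 \<noteq> 0 \<or> w $ 2 \<noteq> 0" using w(1) by (simp add: vec_eq_iff forall_2)
  then have P: "det P \<noteq> 0" unfolding P_def by (auto simp: det_mat2)
  define e where "e = (vector [1, 0] :: 'a^2)"
  have Pe: "P *v e = w" unfolding P_def e_def by (simp add: mat2_mult_vec vec_eq_iff forall_2)
  define \<rho> where "\<rho> b = matrix_inv P ** \<theta> (mat2 1 b 0 1) ** P" for b
  have \<rho>_add: "\<rho> (b + c) = \<rho> b ** \<rho> c" if "b \<in> F" "c \<in> F" for b c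
    unfolding \<rho>_def add[OF that] by (metis matrix_mul_assoc matrix_inv_cancel(1)[OF P])
  have \<rho>0: "\<rho> 0 = mat 1" unfolding \<rho>_def one using P by (simp add: matrix_inv_mult)
  have \<rho>_det: "det (\<rho> b) = 1" if "b \<in> F" for b
    unfolding \<rho>_def using det1[OF that] P by (simp add: det_mul det_matrix_inv)
  have "\<rho> 1 *v e = matrix_inv P *v w"
    unfolding \<rho>_def using w(2) Pe by (simp flip: matrix_vector_mul_assoc)
  also have "\<dots> = e"
    unfolding Pe[symmetric] matrix_vector_mul_assoc matrix_inv_mult(2)[OF P] by simp
  finally have fix_e: "\<rho> 1 *v e = e" .
  obtain x where \<rho>1: "\<rho> 1 = mat2 1 x 0 1"
  proof (cases "\<rho> 1" rule: mat2_cases)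
    case (1 a b c d)
    from fix_e have "a = 1" "c = 0"
      unfolding 1 by (simp_all add: e_def mat2_mult_vec vec_eq_iff forall_2)
    moreover from this have "d = 1" using \<rho>_det[OF f(1)] 1 by (simp add: det_mat2)
    ultimately show ?thesis using that 1 by blast
  qed
  have x: "x \<noteq> 0"
  proof
    assume "x = 0"
    then have "\<rho> 1 = \<rho> 0" using \<rho>1 \<rho>0 by (simp add: mat_eq_mat2)
    then have "mat2 1 1 0 1 = mat2 1 0 0 (1::'a)"
      using GL2_embeddingD(2)[OF GL2_embedding_conj[OF \<theta> P]] U[OF f(1)] U[OF f(2)]
      unfolding \<rho>_def inj_on_def by blast
    then show False by (simp add: mat2_eq_iff)
  qed
  \<comment> \<open>The commutant of a nontrivial upper unipotent matrix consists of upper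
    triangular matrices with equal diagonal entries.\<close>
  have tri: "\<rho> b = mat2 (\<rho> b $ 1 $ 1) (\<rho> b $ 1 $ 2) 0 (\<rho> b $ 1 $ 1)" if b: "b \<in> F" for b
  proof (cases "\<rho> b" rule: mat2_cases)
    case (1 a b' c d)
    have "\<rho> 1 ** \<rho> b = \<rho> b ** \<rho> 1"
      using \<rho>_add[OF f(1) b] \<rho>_add[OF b f(1)] by (simp add: add.commute)
    then show ?thesis
      using x unfolding 1 \<rho>1 by (auto simp: mat2_mult mat2_eq_iff)
  qed
  have "\<rho> b $ 1 $ 1 = 1" if b: "b \<in> F" for b
  proof (rule character_of_additive_group_trivial[OF FR p _ _ b])
    show "\<rho> 0 $ 1 $ 1 = 1" unfolding \<rho>0 by (simp add: mat_eq_mat2)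
    fix c d assume cd: "c \<in> F" "d \<in> F"
    have "\<rho> (c + d) = mat2 (\<rho> c $ 1 $ 1) (\<rho> c $ 1 $ 2) 0 (\<rho> c $ 1 $ 1) ** mat2 (\<rho> d $ 1 $ 1) (\<rho> d $ 1 $ 2) 0 (\<rho> d $ 1 $ 1)"
      using \<rho>_add[OF cd] tri[OF cd(1)] tri[OF cd(2)] by simp
    then show "\<rho> (c + d) $ 1 $ 1 = \<rho> c $ 1 $ 1 * \<rho> d $ 1 $ 1" by (simp add: mat2_mult)
  qed
  then have "\<forall>b\<in>F. \<exists>\<beta>. \<rho> b = mat2 1 \<beta> 0 1" using tri by metis
  then show ?thesis using P unfolding \<rho>_def by blast
qed

text \<open>Starting from the triangular form, take as second basis vector the image of the first
  under the image of the swap. An involution exchanges the two, and the base change is upper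
  triangular, so it keeps the unipotents unipotent.\<close>

lemma embedding_normal_form:
  fixes F :: "'a::field set"
  assumes F: "is_subfield F" "finite F" and \<theta>: "GL2_embedding F \<theta>"
  shows "\<exists>P. det P \<noteq> 0 \<and> (\<forall>b\<in>F. \<exists>\<beta>. matrix_inv P ** \<theta> (mat2 1 b 0 1) ** P = mat2 1 \<beta> 0 1) \<and>
    matrix_inv P ** \<theta> (mat2 0 1 1 0) ** P = mat2 0 1 1 0"
proof -
  obtain Q where Q: "det Q \<noteq> 0" "\<forall>b\<in>F. \<exists>\<beta>. matrix_inv Q ** \<theta> (mat2 1 b 0 1) ** Q = mat2 1 \<beta> 0 1"
    using embedding_unipotents_triangular[OF assms] by blast
  define \<eta> where "\<eta> M = matrix_inv Q ** \<theta> M ** Q" for M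
  have \<eta>: "GL2_embedding F \<eta>" unfolding \<eta>_def by (rule GL2_embedding_conj[OF \<theta> Q(1)])
  have "\<forall>b\<in>F. \<exists>\<beta>. \<eta> (mat2 1 b 0 1) = mat2 1 \<beta> 0 1" using Q(2) unfolding \<eta>_def .
  then obtain \<beta> where \<beta>: "\<And>b. b \<in> F \<Longrightarrow> \<eta> (mat2 1 b 0 1) = mat2 1 (\<beta> b) 0 1" by metis
  note FR = is_subfieldD(1)[OF F(1)]
  note f = is_subringD[OF FR]
  have mem: "mat2 1 1 0 1 \<in> carrier (GL2 F)" "mat2 1 0 1 1 \<in> carrier (GL2 F)"
    "mat2 0 1 1 0 \<in> carrier (GL2 F)" "mat2 0 1 1 1 \<in> carrier (GL2 F)"
    using f(1,2) by (auto intro!: mat2_in_GL2[OF F(1)])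
  note hom = GL2_embeddingD(3)[OF \<eta>]
  obtain p q r s where S: "\<eta> (mat2 0 1 1 0) = mat2 p q r s" by (rule mat2_cases)
  have "\<eta> (mat2 0 1 1 0) ** \<eta> (mat2 0 1 1 0) = mat 1"
    using hom[OF mem(3) mem(3)] GL2_embedding_one[OF FR \<eta>] by (simp add: mat2_mult mat_eq_mat2)
  then have sq: "p * p + q * r = 1" "p * q + q * s = 0" "r * p + s * r = 0" "r * q + s * s = 1"
    unfolding S by (simp_all add: mat2_mult mat_eq_mat2 mat2_eq_iff)
  \<comment> \<open>If \<open>r = 0\<close>, the image of the swap is triangular with diagonal
    entries of square 1. The swap conjugates the upper to the lower unipotents, so both kinds would
    have upper unipotent images, which commute; but upper and lower unipotents do not
    commute.\<close>
  have r: "r \<noteq> 0"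
  proof
    assume r: "r = 0"
    have "\<eta> (mat2 1 0 1 1) = \<eta> (mat2 0 1 1 0) ** \<eta> (mat2 1 1 0 1) ** \<eta> (mat2 0 1 1 0)"
      using hom[OF mem(3) mem(1)] hom[OF mem(4) mem(3)] by (simp add: mat2_mult)
    also have "\<dots> = mat2 1 (p * q + (p * \<beta> 1 + q) * s) 0 1"
      unfolding S \<beta>[OF f(1)] using sq unfolding r by (simp add: mat2_mult)
    finally have "\<eta> (mat2 1 0 1 1) ** \<eta> (mat2 1 1 0 1) = \<eta> (mat2 1 1 0 1) ** \<eta> (mat2 1 0 1 1)"
      unfolding \<beta>[OF f(1)] by (simp add: mat2_mult add.commute)
    then have "mat2 1 0 1 1 ** mat2 1 1 0 1 = mat2 1 1 0 1 ** mat2 1 0 1 (1::'a)"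
      using GL2_embeddingD(2)[OF \<eta>] carrier_GL2_mult[OF FR mem(1,2)] carrier_GL2_mult[OF FR mem(2,1)]
      unfolding hom[OF mem(1,2), symmetric] hom[OF mem(2,1), symmetric] inj_on_def by metis
    \<comment> \<open>The upper left entries of the two products are 1 and \<open>1 + 1\<close>,
      which differ in every characteristic.\<close>
    then have "(1::'a) + 0 = 1 + 1" by (simp add: mat2_mult mat2_eq_iff)
    then show False unfolding add_left_cancel by simp
  qed
  \<comment> \<open>The columns of \<open>T\<close> are the first basis vector and its image
    \<open>(p, r)\<close> under the image of the swap.\<close>
  define T where "T = mat2 1 p 0 r"
  have T: "det T \<noteq> 0" unfolding T_def using r by (simp add: det_mat2)
  have conjI': "matrix_inv T ** M ** T = N" if "M ** T = T ** N" for M N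
    by (metis that matrix_mul_assoc matrix_inv_cancel(2)[OF T])
  have "matrix_inv T ** \<eta> (mat2 0 1 1 0) ** T = mat2 0 1 1 0"
    by (rule conjI') (use sq in \<open>simp add: S T_def mat2_mult mat2_eq_iff algebra_simps\<close>)
  moreover have "matrix_inv T ** \<eta> (mat2 1 b 0 1) ** T = mat2 1 (\<beta> b * r) 0 1" if "b \<in> F" for b
    by (rule conjI') (simp add: \<beta>[OF that] T_def mat2_mult mat2_eq_iff)
  moreover have "matrix_inv T ** \<eta> M ** T = matrix_inv (Q ** T) ** \<theta> M ** (Q ** T)" for M
    unfolding \<eta>_def matrix_inv_matrix_mult[OF Q(1) T] by (simp add: matrix_mul_assoc)
  ultimately show ?thesis
    using Q(1) T by (intro exI[of _ "Q ** T"]) (auto simp: det_mul)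
qed

text \<open>Unipotents, diagonal matrices and the swap generate \<open>GL2 F\<close>, so constancy
  of the entries is needed only for their images. The relation with the swap transfers constancy
  from the diagonal matrices to the unipotents.\<close>

lemma embedding_normalized_image:
  fixes F :: "'a::field set"
  assumes F: "is_subfield F" "finite F" "\<And>x. algebraic_over F x \<Longrightarrow> x \<in> F"
    and \<theta>: "GL2_embedding F \<theta>"
    and U: "\<forall>b\<in>F. \<exists>\<beta>. \<theta> (mat2 1 b 0 1) = mat2 1 \<beta> 0 1"
    and S: "\<theta> (mat2 0 1 1 0) = mat2 0 1 1 0"
    and M: "M \<in> carrier (GL2 F)"
  shows "\<theta> M \<in> carrier (GL2 F)"
proof -
  note FR = is_subfieldD(1)[OF F(1)]
  note f = is_subringD[OF FR] and fdiv = is_subfieldD(3)[OF F(1)]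
  note hom = GL2_embeddingD(3)[OF \<theta>]
  obtain \<beta> where \<beta>: "\<And>b. b \<in> F \<Longrightarrow> \<theta> (mat2 1 b 0 1) = mat2 1 (\<beta> b) 0 1"
    using U by metis
  have upper: "mat2 1 b 0 1 \<in> carrier (GL2 F)" and lower: "mat2 1 0 b 1 \<in> carrier (GL2 F)"
    if "b \<in> F" for b
    using that f(1,2) by (auto intro!: mat2_in_GL2[OF F(1)])
  have diag: "mat2 a 0 0 d \<in> carrier (GL2 F)" if "a \<in> F - {0}" "d \<in> F - {0}" for a d
    using that f(1,2) by (auto intro!: mat2_in_GL2[OF F(1)])
  have swap: "mat2 0 1 1 0 \<in> carrier (GL2 F)"
    using f(1,2) by (auto intro!: mat2_in_GL2[OF F(1)])
  have conj_swap: "\<theta> (mat2 0 1 1 0 ** N ** mat2 0 1 1 0) = mat2 0 1 1 0 ** \<theta> N ** mat2 0 1 1 0"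
    if "N \<in> carrier (GL2 F)" for N
    using hom[OF carrier_GL2_mult[OF FR swap that] swap] hom[OF swap that] S by simp
  have \<theta>_lower: "\<theta> (mat2 1 0 b 1) = mat2 1 0 (\<beta> b) 1" if "b \<in> F" for b
    using conj_swap[OF upper[OF that]] \<beta>[OF that] by (simp add: mat2_mult)
  have \<theta>_swapped: "\<theta> (mat2 d 0 0 a) = mat2 0 1 1 0 ** \<theta> (mat2 a 0 0 d) ** mat2 0 1 1 0"
    if "a \<in> F - {0}" "d \<in> F - {0}" for a d
    using conj_swap[OF diag[OF that]] by (simp add: mat2_mult)
  have \<beta>1: "\<beta> 1 \<noteq> 0"
  proof
    assume "\<beta> 1 = 0"
    then have "\<theta> (mat2 1 1 0 1) = \<theta> (mat 1)"
      using \<beta>[OF f(1)] GL2_embedding_one[OF FR \<theta>] by (simp add: mat_eq_mat2)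
    then have "mat2 1 1 0 1 = (mat 1 :: 'a^2^2)"
      using GL2_embeddingD(2)[OF \<theta>] upper[OF f(1)] carrier_GL2_one[OF FR] unfolding inj_on_def by blast
    then show False by (simp add: mat_eq_mat2 mat2_eq_iff)
  qed
  \<comment> \<open>Diagonal matrices normalize the upper unipotents. Comparing the lower right
    entries of diag(a, d) U(1) = U(a/d) diag(a, d) under \<open>\<theta>\<close> gives
    \<open>z * \<beta> 1 = 0\<close>.\<close>
  have z0: "\<theta> (mat2 a 0 0 d) $ 2 $ 1 = 0" if ad: "a \<in> F - {0}" "d \<in> F - {0}" for a d
  proof (cases "\<theta> (mat2 a 0 0 d)" rule: mat2_cases)
    case (1 x y z w)
    have q: "a / d \<in> F" using ad by (intro fdiv) auto
    have "\<theta> (mat2 a 0 0 d) ** \<theta> (mat2 1 1 0 1) = \<theta> (mat2 1 (a / d) 0 1) ** \<theta> (mat2 a 0 0 d)"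
      using hom[OF diag[OF ad] upper[OF f(1)]] hom[OF upper[OF q] diag[OF ad]] ad
      by (simp add: mat2_mult)
    then show ?thesis
      unfolding 1 \<beta>[OF f(1)] \<beta>[OF q] using \<beta>1 by (simp add: mat2_mult mat2_eq_iff)
  qed
  have y0: "\<theta> (mat2 a 0 0 d) $ 1 $ 2 = 0" if ad: "a \<in> F - {0}" "d \<in> F - {0}" for a d
    using z0[OF ad(2,1)] \<theta>_swapped[OF ad]
    by (cases "\<theta> (mat2 a 0 0 d)" rule: mat2_cases) (simp add: mat2_mult)
  \<comment> \<open>On diagonal matrices the upper left entry of the image is multiplicative, so its
    powers all occur among the finitely many upper left entries of images.\<close>
  have x_in: "\<theta> (mat2 a 0 0 d) $ 1 $ 1 \<in> F" if ad: "a \<in> F - {0}" "d \<in> F - {0}" for a d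
  proof (intro F(3) algebraic_over_if_powers_finite[OF FR])
    show "finite ((\<lambda>N. \<theta> N $ 1 $ 1) ` carrier (GL2 F))"
      using finite_carrier_GL2[OF F(2)] by simp
    fix n
    have "a ^ n \<in> F - {0} \<and> d ^ n \<in> F - {0} \<and>
        \<theta> (mat2 (a ^ n) 0 0 (d ^ n)) $ 1 $ 1 = (\<theta> (mat2 a 0 0 d) $ 1 $ 1) ^ n"
    proof (induction n)
      case 0
      show ?case using f(1) GL2_embedding_one[OF FR \<theta>] by (simp add: mat_eq_mat2)
    next
      case (Suc n)
      then have adn: "a ^ n \<in> F - {0}" "d ^ n \<in> F - {0}" by auto
      have "\<theta> (mat2 (a ^ Suc n) 0 0 (d ^ Suc n)) = \<theta> (mat2 a 0 0 d) ** \<theta> (mat2 (a ^ n) 0 0 (d ^ n))"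
        using hom[OF diag[OF ad] diag[OF adn]] by (simp add: mat2_mult)
      also have "\<dots> $ 1 $ 1 = \<theta> (mat2 a 0 0 d) $ 1 $ 1 * \<theta> (mat2 (a ^ n) 0 0 (d ^ n)) $ 1 $ 1"
        using z0[OF adn] by (simp add: matrix_matrix_mult_def sum_2)
      finally show ?case using Suc f(4) ad by auto
    qed
    then show "(\<theta> (mat2 a 0 0 d) $ 1 $ 1) ^ n \<in> (\<lambda>N. \<theta> N $ 1 $ 1) ` carrier (GL2 F)"
      using imageI[OF diag[of "a ^ n" "d ^ n"], of "\<lambda>N. \<theta> N $ 1 $ 1"] by simp
  qed
  have w_in: "\<theta> (mat2 a 0 0 d) $ 2 $ 2 \<in> F" if ad: "a \<in> F - {0}" "d \<in> F - {0}" for a d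
    using x_in[OF ad(2,1)] \<theta>_swapped[OF ad]
    by (cases "\<theta> (mat2 a 0 0 d)" rule: mat2_cases) (simp add: mat2_mult)
  have \<theta>_diag: "\<theta> (mat2 a 0 0 d) \<in> matrices_over F" if ad: "a \<in> F - {0}" "d \<in> F - {0}" for a d
    unfolding matrices_over_def using x_in[OF ad] w_in[OF ad] y0[OF ad] z0[OF ad] f(2) by (auto simp: forall_2)
  have \<beta>_in: "\<beta> b \<in> F" if b: "b \<in> F" for b
  proof (cases "b = 0")
    case True
    then show ?thesis using \<beta>[OF b] GL2_embedding_one[OF FR \<theta>] f(2) by (simp add: mat_eq_mat2 mat2_eq_iff)
  next
    case False
    \<comment> \<open>With this \<open>c\<close> the product U(b) L(c) U(b) has zero diagonal, hence
      is a diagonal matrix times the swap.\<close>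
    define c where "c = - (1 / b)"
    have c: "c \<in> F" unfolding c_def by (intro f(1,5) fdiv b)
    have bc: "b \<in> F - {0}" "c \<in> F - {0}" using b c False unfolding c_def by auto
    obtain x w where xw: "\<theta> (mat2 b 0 0 c) = mat2 x 0 0 w" "x \<in> F"
      using y0[OF bc] z0[OF bc] x_in[OF bc] mat2_eta by metis
    have "mat2 1 b 0 1 ** mat2 1 0 c 1 ** mat2 1 b 0 1 = mat2 b 0 0 c ** mat2 0 1 1 0"
      using False by (simp add: mat2_mult c_def)
    then have "\<theta> (mat2 1 b 0 1) ** \<theta> (mat2 1 0 c 1) ** \<theta> (mat2 1 b 0 1) = \<theta> (mat2 b 0 0 c) ** \<theta> (mat2 0 1 1 0)"
      using hom[OF upper[OF b] lower[OF c]] hom[OF carrier_GL2_mult[OF FR upper[OF b] lower[OF c]] upper[OF b]]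
        hom[OF diag[OF bc] swap] by simp
    then have "mat2 (1 + \<beta> b * \<beta> c) ((1 + \<beta> b * \<beta> c) * \<beta> b + \<beta> b) (\<beta> c) (\<beta> c * \<beta> b + 1) = mat2 0 x w 0"
      unfolding \<beta>[OF b] \<theta>_lower[OF c] xw(1) S by (simp add: mat2_mult)
    \<comment> \<open>The upper left entry makes the bracket vanish, and the upper right entry then
      says that \<open>\<beta> b\<close> equals the diagonal entry \<open>x\<close>.\<close>
    then have "1 + \<beta> b * \<beta> c = 0" "(1 + \<beta> b * \<beta> c) * \<beta> b + \<beta> b = x"
      unfolding mat2_eq_iff by blast+
    then show ?thesis using xw(2) by simp
  qed
  have big: "\<theta> (mat2 a b c d) \<in> matrices_over F"
    if abcd: "{a, b, c, d} \<subseteq> F" "a * d - b * c \<noteq> 0" "a \<noteq> 0" for a b c d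
  proof -
    \<comment> \<open>The Schur complement of \<open>a\<close>: the matrix factors as lower
      unipotent, diagonal, upper unipotent. For \<open>a = 0\<close> the rows are swapped
      first.\<close>
    define e where "e = d - b * c / a"
    have e: "e \<noteq> 0" unfolding e_def using abcd by (simp add: field_simps)
    have mem: "c / a \<in> F" "b / a \<in> F" "a \<in> F - {0}" "e \<in> F - {0}"
      using abcd e unfolding e_def by (auto intro!: f(3,4) fdiv)
    have "mat2 a b c d = mat2 1 0 (c / a) 1 ** mat2 a 0 0 e ** mat2 1 (b / a) 0 1"
      unfolding e_def using abcd(3) by (simp add: mat2_mult mat2_eq_iff field_simps)
    then have "\<theta> (mat2 a b c d) = \<theta> (mat2 1 0 (c / a) 1) ** \<theta> (mat2 a 0 0 e) ** \<theta> (mat2 1 (b / a) 0 1)"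
      using hom[OF lower[OF mem(1)] diag[OF mem(3,4)]]
        hom[OF carrier_GL2_mult[OF FR lower[OF mem(1)] diag[OF mem(3,4)]] upper[OF mem(2)]] by simp
    then show ?thesis
      unfolding \<beta>[OF mem(2)] \<theta>_lower[OF mem(1)]
      using \<theta>_diag[OF mem(3,4)] \<beta>_in[OF mem(1)] \<beta>_in[OF mem(2)] f(1,2)
      by (simp add: matrices_over_mult[OF FR])
  qed
  have "\<theta> M \<in> matrices_over F"
  proof (cases M rule: mat2_cases)
    case (1 a b c d)
    have abcd: "{a, b, c, d} \<subseteq> F" "a * d - b * c \<noteq> 0"
      using carrier_GL2_matrices[OF M] carrier_GL2_det[OF M] unfolding 1 det_mat2 by simp_all
    show ?thesis
    proof (cases "a = 0")
      case True
      then have "\<theta> (mat2 c d a b) \<in> matrices_over F" using abcd by (intro big) auto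
      moreover have "\<theta> M = \<theta> (mat2 0 1 1 0) ** \<theta> (mat2 c d a b)"
        using abcd hom[OF swap mat2_in_GL2[OF F(1), of c d a b]] unfolding 1
        by (simp add: mat2_mult algebra_simps)
      ultimately show ?thesis
        unfolding S using f(1,2) by (simp add: matrices_over_mult[OF FR])
    next
      case False
      then show ?thesis unfolding 1 using big abcd by blast
    qed
  qed
  then show ?thesis
    using carrier_GL2_subfield[OF F(1)] GL2_embeddingD(1)[OF \<theta> M] by blast
qed

lemma embedding_conjugate:
  fixes F :: "'a::field set"
  assumes F: "is_subfield F" "finite F" "\<And>x. algebraic_over F x \<Longrightarrow> x \<in> F"
    and \<theta>: "GL2_embedding F \<theta>"
  shows "\<exists>g. det g \<noteq> 0 \<and> \<theta> ` carrier (GL2 F) = conj_subgroup g (carrier (GL2 F))"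
proof -
  obtain P where P: "det P \<noteq> 0"
    "\<forall>b\<in>F. \<exists>\<beta>. matrix_inv P ** \<theta> (mat2 1 b 0 1) ** P = mat2 1 \<beta> 0 1"
    "matrix_inv P ** \<theta> (mat2 0 1 1 0) ** P = mat2 0 1 1 0"
    using embedding_normal_form[OF F(1,2) \<theta>] by blast
  define \<eta> where "\<eta> M = matrix_inv P ** \<theta> M ** P" for M
  have \<eta>: "GL2_embedding F \<eta>" unfolding \<eta>_def by (rule GL2_embedding_conj[OF \<theta> P(1)])
  have "\<eta> ` carrier (GL2 F) \<subseteq> carrier (GL2 F)"
    using embedding_normalized_image[OF F \<eta>] P(2,3) unfolding \<eta>_def by blast
  \<comment> \<open>An injective self-map of a finite set is onto, which turns the inclusion into
    equality.\<close>
  then have "\<eta> ` carrier (GL2 F) = carrier (GL2 F)"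
    using endo_inj_surj finite_carrier_GL2[OF F(2)] GL2_embeddingD(2)[OF \<eta>] by blast
  moreover have "\<theta> M = P ** \<eta> M ** matrix_inv P" for M
    unfolding \<eta>_def by (metis matrix_mul_assoc matrix_inv_cancel(1,3)[OF P(1)])
  ultimately have "\<theta> ` carrier (GL2 F) = conj_subgroup P (carrier (GL2 F))"
    unfolding conj_subgroup_eq[OF P(1)] by (metis (no_types, lifting) image_cong image_image)
  then show ?thesis using P(1) by blast
qed


section \<open>Torsors from group actions\<close>

text \<open>The common frame of both torsors: \<open>M\<close> will be the normalizer,
  \<open>S\<close> the product of the scalars with \<open>G\<close>, and \<open>X\<close> the
  subgroups or vertices themselves. By \<open>S_orbit\<close> the \<open>G\<close>-orbits are
  \<open>S\<close>-orbits, and normality of \<open>S\<close> lets the quotient permute them. The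
  assumption \<open>free\<close> says that an element preserving one orbit lies in
  \<open>S\<close>.\<close>

lemma quotient_torsor:
  fixes M (structure) and \<alpha> :: "'g \<Rightarrow> 'x \<Rightarrow> 'x"
  assumes S: "S \<lhd> M" and G: "G \<subseteq> S" and X: "X \<noteq> {}"
    and closed: "\<And>g x. g \<in> carrier M \<Longrightarrow> x \<in> X \<Longrightarrow> \<alpha> g x \<in> X"
    and mult: "\<And>g h x. g \<in> carrier M \<Longrightarrow> h \<in> carrier M \<Longrightarrow> x \<in> X \<Longrightarrow> \<alpha> (g \<otimes> h) x = \<alpha> g (\<alpha> h x)"
    and one: "\<And>x. x \<in> X \<Longrightarrow> \<alpha> \<one> x = x"
    and S_orbit: "\<And>s x. s \<in> S \<Longrightarrow> x \<in> X \<Longrightarrow> \<exists>\<gamma>\<in>G. \<alpha> s x = \<alpha> \<gamma> x"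
    and trans: "\<And>x y. x \<in> X \<Longrightarrow> y \<in> X \<Longrightarrow> \<exists>g\<in>carrier M. \<alpha> g x = y"
    and free: "\<And>g \<gamma> x. g \<in> carrier M \<Longrightarrow> \<gamma> \<in> G \<Longrightarrow> x \<in> X \<Longrightarrow> \<alpha> g x = \<alpha> \<gamma> x \<Longrightarrow> g \<in> S"
    and orb: "\<And>x. orb x = (\<lambda>\<gamma>. \<alpha> \<gamma> x) ` G"
  shows "\<exists>\<phi>. (\<forall>g\<in>carrier M. \<forall>x\<in>X. \<phi> (S #> g) (orb x) = orb (\<alpha> g x)) \<and>
    free_transitive_action (M Mod S) (orb ` X) \<phi>"
proof -
  interpret normal S M by (rule S)
  have SM: "s \<in> carrier M" if "s \<in> S" for s using that subset by blast
  note S_one = subgroup.one_closed[OF is_subgroup] and S_mult = subgroup.m_closed[OF is_subgroup]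
    and S_inv = subgroup.m_inv_closed[OF is_subgroup]
  have orbS: "orb x = (\<lambda>s. \<alpha> s x) ` S" if "x \<in> X" for x
    unfolding orb using G S_orbit[OF _ that] by blast
  have orb_self: "x \<in> orb x" if "x \<in> X" for x
    unfolding orbS[OF that] using imageI[OF S_one, of "\<lambda>s. \<alpha> s x"] one[OF that] by simp
  have orb_sub: "orb (\<alpha> s x) \<subseteq> orb x" if s: "s \<in> S" and x: "x \<in> X" for s x
  proof
    fix y assume "y \<in> orb (\<alpha> s x)"
    then obtain t where t: "t \<in> S" "y = \<alpha> t (\<alpha> s x)" unfolding orbS[OF closed[OF SM[OF s] x]] by blast
    then have "y = \<alpha> (t \<otimes> s) x" using mult[OF SM[OF t(1)] SM[OF s] x] by simp
    then show "y \<in> orb x" unfolding orbS[OF x] using S_mult[OF t(1) s] by blast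
  qed
  have inv_act: "\<alpha> (inv g) (\<alpha> g x) = x" "\<alpha> g (\<alpha> (inv g) x) = x" if "g \<in> carrier M" "x \<in> X" for g x
    using mult[of "inv g" g x] mult[of g "inv g" x] that one by simp_all
  have orb_S: "orb (\<alpha> s x) = orb x" if s: "s \<in> S" and x: "x \<in> X" for s x
    using orb_sub[OF s x] orb_sub[OF S_inv[OF s] closed[OF SM[OF s] x]] inv_act(1)[OF SM[OF s] x] by auto
  \<comment> \<open>Other representatives are \<open>s \<otimes> g\<close> and
    \<open>\<alpha> t x\<close> with \<open>s\<close>, \<open>t\<close> in \<open>S\<close>. Moving
    \<open>t\<close> past \<open>g\<close> conjugates it by \<open>g\<close>, and the result stays
    in \<open>S\<close>.\<close>
  have welldef: "orb (\<alpha> g x) = orb (\<alpha> g' x')"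
    if g: "g \<in> carrier M" "g' \<in> carrier M" "S #> g = S #> g'" and x: "x \<in> X" "x' \<in> X" "orb x = orb x'"
    for g g' x x'
  proof -
    obtain t where t: "t \<in> S" "x' = \<alpha> t x" using orb_self[OF x(2)] x(3) orbS[OF x(1)] by blast
    have "g' \<in> S #> g" using g rcos_self[OF _ is_subgroup] by simp
    then obtain s where s: "s \<in> S" "g' = s \<otimes> g" unfolding r_coset_def by blast
    have "\<alpha> g' x' = \<alpha> s (\<alpha> (g \<otimes> t) x)"
      unfolding s(2) t(2) using mult g(1) x(1) s t closed SM by simp
    also have "g \<otimes> t = (g \<otimes> t \<otimes> inv g) \<otimes> g"
      using g(1) t SM by (simp add: m_assoc)
    also have "\<alpha> ((g \<otimes> t \<otimes> inv g) \<otimes> g) x = \<alpha> (g \<otimes> t \<otimes> inv g) (\<alpha> g x)"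
      using g(1) t SM x(1) by (intro mult) auto
    finally have "\<alpha> g' x' = \<alpha> s (\<alpha> (g \<otimes> t \<otimes> inv g) (\<alpha> g x))" .
    moreover have "g \<otimes> t \<otimes> inv g \<in> S" using inv_op_closed2 g(1) t(1) by blast
    ultimately show ?thesis using s(1) g(1) x(1) closed SM orb_S by simp
  qed
  \<comment> \<open>Representatives are chosen arbitrarily; the restriction to the set of orbits
    makes each \<open>\<phi> q\<close> extensional, as \<open>Bij\<close> demands.\<close>
  define \<phi> where "\<phi> q = (\<lambda>w\<in>orb ` X. orb (\<alpha> (SOME g. g \<in> carrier M \<and> q = S #> g) (SOME x. x \<in> X \<and> w = orb x)))" for q
  have \<phi>: "\<phi> (S #> g) (orb x) = orb (\<alpha> g x)" if g: "g \<in> carrier M" and x: "x \<in> X" for g x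
  proof -
    define g' where "g' = (SOME g'. g' \<in> carrier M \<and> S #> g = S #> g')"
    define x' where "x' = (SOME x'. x' \<in> X \<and> orb x = orb x')"
    have g': "g' \<in> carrier M \<and> S #> g = S #> g'" unfolding g'_def by (rule someI[of _ g]) (use g in simp)
    have x': "x' \<in> X \<and> orb x = orb x'" unfolding x'_def by (rule someI[of _ x]) (use x in simp)
    have "\<phi> (S #> g) (orb x) = orb (\<alpha> g' x')" unfolding \<phi>_def g'_def x'_def using x by simp
    then show ?thesis using welldef[of g g' x x'] g g' x x' by simp
  qed
  have car: "\<exists>g\<in>carrier M. q = S #> g" if "q \<in> carrier (M Mod S)" for q
    using that unfolding FactGroup_def RCOSETS_def by auto
  have carI: "S #> g \<in> carrier (M Mod S)" if "g \<in> carrier M" for g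
    using that unfolding FactGroup_def RCOSETS_def by auto
  have Bij: "\<phi> (S #> g) \<in> Bij (orb ` X)" if g: "g \<in> carrier M" for g
  proof -
    have "bij_betw (\<phi> (S #> g)) (orb ` X) (orb ` X)"
      by (rule bij_betw_byWitness[where f' = "\<phi> (S #> inv g)"]) (use g in \<open>auto simp: \<phi> closed inv_act\<close>)
    then show ?thesis unfolding Bij_def \<phi>_def by auto
  qed
  have hom: "group_hom (M Mod S) (BijGroup (orb ` X)) \<phi>"
  proof (rule group_hom.intro[OF factorgroup_is_group group_BijGroup], unfold_locales, rule homI)
    fix q assume "q \<in> carrier (M Mod S)"
    then show "\<phi> q \<in> carrier (BijGroup (orb ` X))" using car Bij unfolding BijGroup_def by auto
  next
    fix q r assume "q \<in> carrier (M Mod S)" "r \<in> carrier (M Mod S)"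
    then obtain g h where gh: "g \<in> carrier M" "q = S #> g" "h \<in> carrier M" "r = S #> h" using car by metis
    have qr: "q \<otimes>\<^bsub>M Mod S\<^esub> r = S #> (g \<otimes> h)" unfolding gh FactGroup_def using gh rcos_sum by simp
    have "\<phi> (S #> (g \<otimes> h)) = compose (orb ` X) (\<phi> q) (\<phi> r)"
    proof
      fix w
      show "\<phi> (S #> (g \<otimes> h)) w = compose (orb ` X) (\<phi> q) (\<phi> r) w"
      proof (cases "w \<in> orb ` X")
        case True
        then obtain x where "x \<in> X" "w = orb x" by blast
        then show ?thesis unfolding gh(2,4) compose_def using gh(1,3) by (simp add: \<phi> closed mult)
      next
        case False
        then show ?thesis unfolding compose_def \<phi>_def by simp
      qed
    qed
    then show "\<phi> (q \<otimes>\<^bsub>M Mod S\<^esub> r) = \<phi> q \<otimes>\<^bsub>BijGroup (orb ` X)\<^esub> \<phi> r"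
      unfolding qr using Bij[OF gh(1)] Bij[OF gh(3)] unfolding gh(2,4) BijGroup_def by simp
  qed
  have "transitive_action (M Mod S) (orb ` X) \<phi>"
  proof (intro transitive_action.intro group_action.intro hom transitive_action_axioms.intro)
    fix w w' assume "w \<in> orb ` X" "w' \<in> orb ` X"
    then obtain x x' where x: "x \<in> X" "w = orb x" "x' \<in> X" "w' = orb x'" by blast
    then obtain g where "g \<in> carrier M" "\<alpha> g x = x'" using trans by blast
    then show "\<exists>q\<in>carrier (M Mod S). \<phi> q w = w'"
      using x carI \<phi> by (intro bexI[of _ "S #> g"]) auto
  qed
  moreover have "stabilizer (M Mod S) \<phi> w = {\<one>\<^bsub>M Mod S\<^esub>}" if w: "w \<in> orb ` X" for w
  proof -
    obtain x where x: "x \<in> X" "w = orb x" using w by blast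
    have one_q: "\<one>\<^bsub>M Mod S\<^esub> = S #> \<one>" unfolding FactGroup_def using coset_mult_one subset by simp
    have "q = \<one>\<^bsub>M Mod S\<^esub>" if q: "q \<in> carrier (M Mod S)" "\<phi> q w = w" for q
    proof -
      obtain g where g: "g \<in> carrier M" "q = S #> g" using car q(1) by blast
      then have "\<alpha> g x \<in> orb x" using q(2) x \<phi> orb_self[OF closed[OF g(1) x(1)]] by simp
      then have "g \<in> S" using free[OF g(1) _ x(1)] unfolding orb by blast
      then show ?thesis unfolding g(2) FactGroup_def using rcos_const by simp
    qed
    moreover have "\<phi> \<one>\<^bsub>M Mod S\<^esub> w = w" unfolding one_q using x \<phi> one by simp
    ultimately show ?thesis
      unfolding stabilizer_def using carI[OF SM[OF S_one]] one_q by auto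
  qed
  ultimately have "free_transitive_action (M Mod S) (orb ` X) \<phi>"
    unfolding free_transitive_action_def using X by simp
  then show ?thesis using \<phi> by blast
qed

section \<open>The Quinn group and subgroups isomorphic to \<open>GL\<^sub>2(F)\<close>\<close>

lemma inv_GL2_subring:
  assumes R: "is_subring R" and g: "g \<in> carrier (GL2 R)"
  shows "inv\<^bsub>GL2 R\<^esub> g = matrix_inv g"
  using g group.inv_equality[OF group_GL2[OF R], of "matrix_inv g" g]
  by (simp add: carrier_GL2_inv carrier_GL2_det matrix_inv_mult)

lemma normalizer_GL2_group:
  assumes A: "is_subring A"
  shows subgroup_normalizer_GL2: "subgroup (normalizer_GL2 A) (GL2 UNIV)"
    and group_normalizer_GL2: "group ((GL2 UNIV)\<lparr>carrier := normalizer_GL2 A\<rparr>)"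
    and normalizer_GL2_mult: "g \<in> normalizer_GL2 A \<Longrightarrow> h \<in> normalizer_GL2 A \<Longrightarrow> g ** h \<in> normalizer_GL2 A"
    and normalizer_GL2_inv: "g \<in> normalizer_GL2 A \<Longrightarrow> matrix_inv g \<in> normalizer_GL2 A"
    and inv_normalizer_GL2: "g \<in> normalizer_GL2 A \<Longrightarrow>
      inv\<^bsub>(GL2 UNIV)\<lparr>carrier := normalizer_GL2 A\<rparr>\<^esub> g = matrix_inv g"
proof -
  show sub: "subgroup (normalizer_GL2 A) (GL2 UNIV)"
    by (rule group.normalizer_imp_subgroup[OF group_GL2_UNIV]) (use carrier_GL2_mono in blast)
  then show "group ((GL2 UNIV)\<lparr>carrier := normalizer_GL2 A\<rparr>)"
    by (rule group.subgroup_imp_group[OF group_GL2_UNIV])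
  show "g \<in> normalizer_GL2 A \<Longrightarrow> h \<in> normalizer_GL2 A \<Longrightarrow> g ** h \<in> normalizer_GL2 A"
    using subgroup.m_closed[OF sub] by simp
  show "g \<in> normalizer_GL2 A \<Longrightarrow> matrix_inv g \<in> normalizer_GL2 A"
    using subgroup.m_inv_closed[OF sub, of g] by (simp add: inv_GL2 normalizer_GL2_iff)
  show "g \<in> normalizer_GL2 A \<Longrightarrow> inv\<^bsub>(GL2 UNIV)\<lparr>carrier := normalizer_GL2 A\<rparr>\<^esub> g = matrix_inv g"
    using group.m_inv_consistent[OF group_GL2_UNIV sub, of g] by (simp add: inv_GL2 normalizer_GL2_iff)
qed

lemma carrier_GL2_normalizer:
  assumes A: "is_subring A" and g: "g \<in> carrier (GL2 A)"
  shows "g \<in> normalizer_GL2 A"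
proof -
  have sub: "conj_subgroup h (carrier (GL2 A)) \<subseteq> carrier (GL2 A)" if "h \<in> carrier (GL2 A)" for h
    using that by (auto simp: conj_subgroup_eq carrier_GL2_det intro!: carrier_GL2_mult[OF A] carrier_GL2_inv)
  have d: "det g \<noteq> 0" using carrier_GL2_det[OF g] .
  have "carrier (GL2 A) = conj_subgroup g (conj_subgroup (matrix_inv g) (carrier (GL2 A)))"
    using conj_subgroup_inv[of "matrix_inv g"] d by (simp add: det_matrix_inv matrix_inv_matrix_inv)
  also have "\<dots> \<subseteq> conj_subgroup g (carrier (GL2 A))"
    using sub[OF carrier_GL2_inv[OF g]] by (auto simp: conj_subgroup_eq[OF d])
  finally show ?thesis using sub[OF g] d unfolding normalizer_GL2_iff by blast
qed

lemma det_mat: "c \<noteq> 0 \<Longrightarrow> det (mat c :: 'a::field^2^2) \<noteq> 0"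
  by (simp add: mat_eq_mat2 det_mat2)

lemma mat_normalizer: "c \<noteq> 0 \<Longrightarrow> mat c \<in> normalizer_GL2 A"
  by (simp add: normalizer_GL2_iff conj_subgroup_mat det_mat)

lemma scalars_GL2_iff: "s \<in> scalars_GL2 A \<longleftrightarrow> (\<exists>c \<gamma>. c \<noteq> 0 \<and> \<gamma> \<in> carrier (GL2 A) \<and> s = mat c ** \<gamma>)"
  unfolding set_mult_def scalar_matrices_def by auto

lemma carrier_GL2_scalars: "\<gamma> \<in> carrier (GL2 A) \<Longrightarrow> \<gamma> \<in> scalars_GL2 A"
  unfolding scalars_GL2_iff by (rule exI[of _ 1]) auto

text \<open>Scalars are central and the normalizer preserves \<open>GL2 A\<close>, so conjugation
  acts on the second factor alone.\<close>

lemma scalars_GL2_normal: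
  fixes A :: "'a::field set"
  assumes A: "is_subring A"
  shows "scalars_GL2 A \<lhd> (GL2 UNIV)\<lparr>carrier := normalizer_GL2 A\<rparr>"
proof -
  define M where "M = (GL2 (UNIV :: 'a set))\<lparr>carrier := normalizer_GL2 A\<rparr>"
  have M: "group M" unfolding M_def by (rule group_normalizer_GL2[OF A])
  have inv_M: "inv\<^bsub>M\<^esub> g = matrix_inv g" if "g \<in> normalizer_GL2 A" for g
    unfolding M_def by (rule inv_normalizer_GL2[OF A that])
  have sub: "scalars_GL2 A \<subseteq> normalizer_GL2 A"
    using normalizer_GL2_mult[OF A mat_normalizer carrier_GL2_normalizer[OF A]]
    by (auto simp: scalars_GL2_iff)
  have mat_mult: "mat c ** mat d = (mat (c * d) :: 'a^2^2)" for c d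
    by (simp add: mat_eq_mat2 mat2_mult)
  have "subgroup (scalars_GL2 A) M"
  proof (rule group.subgroupI[OF M])
    show "scalars_GL2 A \<subseteq> carrier M" using sub unfolding M_def by simp
    show "scalars_GL2 A \<noteq> {}" using carrier_GL2_scalars carrier_GL2_one[OF A] by blast
    fix s assume s: "s \<in> scalars_GL2 A"
    then obtain c \<gamma> where c: "c \<noteq> 0" "\<gamma> \<in> carrier (GL2 A)" "s = mat c ** \<gamma>"
      unfolding scalars_GL2_iff by blast
    have d: "det (mat c :: 'a^2^2) \<noteq> 0" using c(1) by (simp add: mat_eq_mat2 det_mat2)
    have "matrix_inv (mat c :: 'a^2^2) = mat (1 / c)"
      using c(1) by (intro matrix_inv_eqI) (simp add: mat_mult)
    then have "inv\<^bsub>M\<^esub> s = mat (1 / c) ** matrix_inv \<gamma>"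
      using s sub inv_M c d carrier_GL2_det[OF c(2)]
      by (simp add: matrix_inv_matrix_mult mat_mult_commute subset_iff)
    then show "inv\<^bsub>M\<^esub> s \<in> scalars_GL2 A"
      unfolding scalars_GL2_iff using c carrier_GL2_inv by (metis divide_eq_0_iff one_neq_zero)
    fix t assume "t \<in> scalars_GL2 A"
    then obtain e \<delta> where e: "e \<noteq> 0" "\<delta> \<in> carrier (GL2 A)" "t = mat e ** \<delta>"
      unfolding scalars_GL2_iff by blast
    have "s ** t = mat (c * e) ** (\<gamma> ** \<delta>)"
      unfolding c(3) e(3) mat_mult[symmetric] by (metis mat_mult_commute matrix_mul_assoc)
    then show "s \<otimes>\<^bsub>M\<^esub> t \<in> scalars_GL2 A"
      unfolding scalars_GL2_iff M_def using c(1,2) e(1,2) carrier_GL2_mult[OF A, of \<gamma> \<delta>]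
      by (intro exI[of _ "c * e"] exI[of _ "\<gamma> ** \<delta>"]) simp
  qed
  moreover have "g \<otimes>\<^bsub>M\<^esub> s \<otimes>\<^bsub>M\<^esub> inv\<^bsub>M\<^esub> g \<in> scalars_GL2 A"
    if g: "g \<in> carrier M" and s: "s \<in> scalars_GL2 A" for g s
  proof -
    have g: "g \<in> normalizer_GL2 A" using g unfolding M_def by simp
    then have gN: "det g \<noteq> 0" "conj_subgroup g (carrier (GL2 A)) = carrier (GL2 A)"
      unfolding normalizer_GL2_iff by auto
    obtain c \<gamma> where c: "c \<noteq> 0" "\<gamma> \<in> carrier (GL2 A)" "s = mat c ** \<gamma>"
      using s unfolding scalars_GL2_iff by blast
    have "g ** \<gamma> ** matrix_inv g \<in> carrier (GL2 A)"
      using gN c(2) by (auto simp: conj_subgroup_eq)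
    moreover have "g \<otimes>\<^bsub>M\<^esub> s \<otimes>\<^bsub>M\<^esub> inv\<^bsub>M\<^esub> g = mat c ** (g ** \<gamma> ** matrix_inv g)"
      unfolding inv_M[OF g] unfolding M_def c(3) using mat_mult_commute[of c g]
      by (simp add: matrix_mul_assoc)
    ultimately show ?thesis unfolding scalars_GL2_iff using c(1) by blast
  qed
  ultimately show ?thesis
    unfolding M_def[symmetric] by (intro group.normal_invI[OF M])
qed

text \<open>A right coset depends only on the multiplication, which restricting the carrier leaves
  unchanged.\<close>

lemma quinn_class_eq: "quinn_class A g = scalars_GL2 A #>\<^bsub>(GL2 UNIV)\<lparr>carrier := normalizer_GL2 A\<rparr>\<^esub> g"
  unfolding quinn_class_def r_coset_def by simp

lemma iso_conj:
  assumes A: "is_subring A" and g: "det g \<noteq> 0"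
    and H: "subgroup H (GL2 A)" and sub: "conj_subgroup g H \<subseteq> carrier (GL2 A)"
  shows subgroup_conj_subgroup: "subgroup (conj_subgroup g H) (GL2 A)"
    and conj_subgroup_iso: "(GL2 A)\<lparr>carrier := H\<rparr> \<cong> (GL2 A)\<lparr>carrier := conj_subgroup g H\<rparr>"
proof -
  define \<kappa> where "\<kappa> h = g ** h ** matrix_inv g" for h
  have im: "conj_subgroup g H = \<kappa> ` H" unfolding \<kappa>_def conj_subgroup_eq[OF g] ..
  have mult: "\<kappa> (h ** k) = \<kappa> h ** \<kappa> k" for h k
    unfolding \<kappa>_def by (metis matrix_mul_assoc matrix_inv_cancel(2)[OF g])
  have inj: "inj \<kappa>"
    unfolding \<kappa>_def inj_on_def by (metis matrix_mul_assoc matrix_inv_cancel(2,4)[OF g])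
  have HA: "H \<subseteq> carrier (GL2 A)" using subgroup.subset[OF H] .
  show "subgroup (conj_subgroup g H) (GL2 A)"
  proof (rule group.subgroupI[OF group_GL2[OF A] sub])
    show "conj_subgroup g H \<noteq> {}" unfolding im using subgroup.one_closed[OF H] by blast
    fix x assume x: "x \<in> conj_subgroup g H"
    then obtain h where h: "h \<in> H" "x = \<kappa> h" unfolding im by blast
    have hA: "h \<in> carrier (GL2 A)" using h(1) HA by blast
    have "inv\<^bsub>GL2 A\<^esub> x = matrix_inv (\<kappa> h)"
      using inv_GL2_subring[OF A, of x] sub x h by blast
    also have "\<dots> = \<kappa> (matrix_inv h)"
      using g carrier_GL2_det[OF hA]
      by (simp add: \<kappa>_def matrix_inv_matrix_mult det_mul det_matrix_inv matrix_inv_matrix_inv matrix_mul_assoc)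
    finally show "inv\<^bsub>GL2 A\<^esub> x \<in> conj_subgroup g H"
      unfolding im using subgroup.m_inv_closed[OF H h(1)] inv_GL2_subring[OF A hA] by simp
    fix y assume "y \<in> conj_subgroup g H"
    then obtain k where k: "k \<in> H" "y = \<kappa> k" unfolding im by blast
    then show "x \<otimes>\<^bsub>GL2 A\<^esub> y \<in> conj_subgroup g H"
      unfolding im h(2) using subgroup.m_closed[OF H h(1) k(1)] by (simp flip: mult)
  qed
  have "\<kappa> \<in> iso ((GL2 A)\<lparr>carrier := H\<rparr>) ((GL2 A)\<lparr>carrier := conj_subgroup g H\<rparr>)"
    unfolding iso_def hom_def im using inj by (auto simp: mult bij_betw_def inj_on_def)
  then show "(GL2 A)\<lparr>carrier := H\<rparr> \<cong> (GL2 A)\<lparr>carrier := conj_subgroup g H\<rparr>"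
    unfolding is_iso_def by blast
qed

section \<open>Subgroups isomorphic to \<open>GL2 F\<close> and the torsor of their classes\<close>

locale constants_in_ring =
  fixes F A :: "'k::field set"
  assumes subfield: "is_subfield F" and finite_F: "finite F"
    and alg_closed: "\<And>x. algebraic_over F x \<Longrightarrow> x \<in> F"
    and subring: "is_subring A" and F_subset: "F \<subseteq> A"
begin

lemmas subring_F = is_subfieldD(1)[OF subfield]

lemma GL2_F_subset: "carrier (GL2 F) \<subseteq> carrier (GL2 A)"
  by (rule carrier_GL2_mono[OF F_subset])

lemma subgroup_GL2_F: "subgroup (carrier (GL2 F)) (GL2 A)"
  by (rule group.subgroupI[OF group_GL2[OF subring] GL2_F_subset])
    (use GL2_F_subset carrier_GL2_one[OF subring_F] in
      \<open>auto simp: inv_GL2_subring[OF subring] subset_iff intro: carrier_GL2_inv carrier_GL2_mult[OF subring_F]\<close>)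

text \<open>This trades an isomorphism condition for an orbit of the normalizer. Transitivity,
  nonemptiness and invariance under conjugation are all read off from it.\<close>

lemma GL2_subgroups_eq:
  "GL2_subgroups F A = (\<lambda>g. conj_subgroup g (carrier (GL2 F))) ` normalizer_GL2 A"
proof (intro equalityI subsetI)
  fix H assume "H \<in> GL2_subgroups F A"
  then have H: "subgroup H (GL2 A)" "(GL2 A)\<lparr>carrier := H\<rparr> \<cong> GL2 F"
    unfolding GL2_subgroups_def by auto
  have "GL2 F \<cong> (GL2 A)\<lparr>carrier := H\<rparr>"
    using group.iso_sym[OF group.subgroup_imp_group[OF group_GL2[OF subring] H(1)] H(2)] .
  then obtain \<theta> where \<theta>: "\<theta> \<in> iso (GL2 F) ((GL2 A)\<lparr>carrier := H\<rparr>)" unfolding is_iso_def by blast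
  have HA: "H \<subseteq> carrier (GL2 A)" using subgroup.subset[OF H(1)] .
  have im: "\<theta> ` carrier (GL2 F) = H" and "inj_on \<theta> (carrier (GL2 F))"
    using \<theta> unfolding iso_def bij_betw_def by auto
  moreover have "\<theta> (M ** N) = \<theta> M ** \<theta> N" if "M \<in> carrier (GL2 F)" "N \<in> carrier (GL2 F)" for M N
    using \<theta> that unfolding iso_def hom_def by auto
  moreover have "det (\<theta> M) \<noteq> 0" if "M \<in> carrier (GL2 F)" for M
    using im that HA carrier_GL2_det by blast
  ultimately have "GL2_embedding F \<theta>" unfolding GL2_embedding_def by blast
  then obtain g where g: "det g \<noteq> 0" "H = conj_subgroup g (carrier (GL2 F))"
    using embedding_conjugate[OF subfield finite_F alg_closed] im by metis
  have "products_in A g"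
  proof (rule products_in_if_conj[OF subring_F subring g(1)])
    fix h assume "h \<in> carrier (GL2 F)"
    then have "g ** h ** matrix_inv g \<in> H" unfolding g(2) conj_subgroup_eq[OF g(1)] by blast
    then show "g ** h ** matrix_inv g \<in> matrices_over A" using HA carrier_GL2_matrices by blast
  qed
  then show "H \<in> (\<lambda>g. conj_subgroup g (carrier (GL2 F))) ` normalizer_GL2 A"
    using products_in_normalizer[OF subring g(1)] g(2) by blast
next
  fix H assume "H \<in> (\<lambda>g. conj_subgroup g (carrier (GL2 F))) ` normalizer_GL2 A"
  then obtain g where "g \<in> normalizer_GL2 A" and H: "H = conj_subgroup g (carrier (GL2 F))"
    by blast
  then have g: "det g \<noteq> 0" "conj_subgroup g (carrier (GL2 A)) = carrier (GL2 A)"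
    unfolding normalizer_GL2_iff by auto
  have sub: "conj_subgroup g (carrier (GL2 F)) \<subseteq> carrier (GL2 A)"
    using g(2) GL2_F_subset unfolding conj_subgroup_eq[OF g(1)] by blast
  note conj = iso_conj[OF subring g(1) subgroup_GL2_F sub]
  have "(GL2 A)\<lparr>carrier := carrier (GL2 F)\<rparr> = GL2 F" by (simp add: GL2_def)
  then have "GL2 F \<cong> (GL2 A)\<lparr>carrier := H\<rparr>" using conj(2) unfolding H by simp
  then have "(GL2 A)\<lparr>carrier := H\<rparr> \<cong> GL2 F" by (rule group.iso_sym[OF group_GL2[OF subring_F]])
  then show "H \<in> GL2_subgroups F A" unfolding GL2_subgroups_def using conj(1) H by blast
qed

lemma conj_subgroup_in_GL2_subgroups:
  assumes "g \<in> normalizer_GL2 A" "H \<in> GL2_subgroups F A"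
  shows "conj_subgroup g H \<in> GL2_subgroups F A"
proof -
  obtain h where h: "h \<in> normalizer_GL2 A" "H = conj_subgroup h (carrier (GL2 F))"
    using assms(2) unfolding GL2_subgroups_eq by blast
  have "conj_subgroup g H = conj_subgroup (g ** h) (carrier (GL2 F))"
    unfolding h(2) using assms(1) h(1) by (simp add: conj_subgroup_mult normalizer_GL2_iff)
  then show ?thesis
    unfolding GL2_subgroups_eq using normalizer_GL2_mult[OF subring assms(1) h(1)] by blast
qed

lemma conj_subgroup_scalars:
  assumes "s \<in> scalars_GL2 A"
  shows "\<exists>\<gamma>\<in>carrier (GL2 A). conj_subgroup s H = conj_subgroup \<gamma> H"
proof -
  obtain c \<gamma> where c: "c \<noteq> 0" "\<gamma> \<in> carrier (GL2 A)" "s = mat c ** \<gamma>"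
    using assms unfolding scalars_GL2_iff by blast
  have "det (mat c :: 'k^2^2) \<noteq> 0" using c(1) by (simp add: mat_eq_mat2 det_mat2)
  then show ?thesis
    using c carrier_GL2_det[OF c(2)] by (auto simp: conj_subgroup_mult conj_subgroup_mat)
qed

text \<open>The element \<open>matrix_inv \<gamma> ** g\<close> normalizes \<open>H\<close>.
  Transported to the base subgroup it normalizes \<open>GL2 F\<close>, hence is a scalar times an
  element of \<open>GL2 F\<close>; transporting it back stays within the normal subgroup
  \<open>scalars_GL2 A\<close>.\<close>

lemma conj_eq_imp_scalars:
  assumes g: "g \<in> normalizer_GL2 A" and \<gamma>: "\<gamma> \<in> carrier (GL2 A)" and H: "H \<in> GL2_subgroups F A"
    and eq: "conj_subgroup g H = conj_subgroup \<gamma> H"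
  shows "g \<in> scalars_GL2 A"
proof -
  interpret S: normal "scalars_GL2 A" "(GL2 UNIV)\<lparr>carrier := normalizer_GL2 A\<rparr>"
    by (rule scalars_GL2_normal[OF subring])
  obtain h where h: "h \<in> normalizer_GL2 A" "H = conj_subgroup h (carrier (GL2 F))"
    using H unfolding GL2_subgroups_eq by blast
  have det: "det g \<noteq> 0" "det h \<noteq> 0" "det \<gamma> \<noteq> 0"
    using g h(1) carrier_GL2_det[OF \<gamma>] unfolding normalizer_GL2_iff by auto
  define n where "n = matrix_inv h ** (matrix_inv \<gamma> ** g) ** h"
  have n: "det n \<noteq> 0" unfolding n_def using det by (simp add: det_mul det_matrix_inv)
  have "conj_subgroup n (carrier (GL2 F)) = conj_subgroup (matrix_inv h) (conj_subgroup (matrix_inv \<gamma>) (conj_subgroup g H))"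
    unfolding n_def h(2) using det by (simp add: conj_subgroup_mult det_mul det_matrix_inv)
  also have "\<dots> = carrier (GL2 F)"
    unfolding eq using det by (simp add: conj_subgroup_inv h(2))
  finally have "n ** k ** matrix_inv n \<in> matrices_over F" if "k \<in> carrier (GL2 F)" for k
    using that carrier_GL2_matrices unfolding conj_subgroup_eq[OF n] by blast
  then have "products_in F n" by (rule products_in_if_conj[OF subring_F subring_F n])
  then have "n \<in> scalars_GL2 A"
    using products_in_subfield[OF subfield n] GL2_F_subset unfolding scalars_GL2_iff by blast
  then have "h ** n ** matrix_inv h \<in> scalars_GL2 A"
    using S.inv_op_closed2[of h n] h(1) by (simp add: inv_normalizer_GL2[OF subring])
  moreover have "h ** n ** matrix_inv h = matrix_inv \<gamma> ** g"
    unfolding n_def by (metis matrix_mul_assoc matrix_inv_cancel(1,3)[OF det(2)])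
  ultimately have "matrix_inv \<gamma> ** g \<in> scalars_GL2 A" by simp
  from subgroup.m_closed[OF S.is_subgroup carrier_GL2_scalars[OF \<gamma>] this] show ?thesis
    by (simp add: matrix_inv_cancel(1)[OF det(3)])
qed

lemma Quinn_torsor_subgroups:
  "\<exists>\<phi>. (\<forall>g\<in>normalizer_GL2 A. \<forall>H\<in>GL2_subgroups F A.
           \<phi> (quinn_class A g) (conj_class A H) = conj_class A (conj_subgroup g H)) \<and>
        free_transitive_action (Quinn A) (conj_class A ` GL2_subgroups F A) \<phi>"
proof -
  have "\<exists>\<phi>. (\<forall>g\<in>carrier ((GL2 UNIV)\<lparr>carrier := normalizer_GL2 A\<rparr>). \<forall>H\<in>GL2_subgroups F A.
           \<phi> (scalars_GL2 A #>\<^bsub>(GL2 UNIV)\<lparr>carrier := normalizer_GL2 A\<rparr>\<^esub> g) (conj_class A H) = conj_class A (conj_subgroup g H)) \<and>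
        free_transitive_action ((GL2 UNIV)\<lparr>carrier := normalizer_GL2 A\<rparr> Mod scalars_GL2 A) (conj_class A ` GL2_subgroups F A) \<phi>"
  proof (rule quotient_torsor[OF scalars_GL2_normal[OF subring], where G = "carrier (GL2 A)"])
    show "carrier (GL2 A) \<subseteq> scalars_GL2 A" using carrier_GL2_scalars by blast
    show "GL2_subgroups F A \<noteq> {}"
      unfolding GL2_subgroups_eq using carrier_GL2_normalizer[OF subring carrier_GL2_one[OF subring]] by blast
    show "conj_class A H = (\<lambda>\<gamma>. conj_subgroup \<gamma> H) ` carrier (GL2 A)" for H
      unfolding conj_class_def orbit_def by blast
    show "\<exists>\<gamma>\<in>carrier (GL2 A). conj_subgroup s H = conj_subgroup \<gamma> H" if "s \<in> scalars_GL2 A" for s H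
      by (rule conj_subgroup_scalars[OF that])
    fix H assume H: "H \<in> GL2_subgroups F A"
    show "conj_subgroup \<one>\<^bsub>(GL2 UNIV)\<lparr>carrier := normalizer_GL2 A\<rparr>\<^esub> H = H"
      by (simp add: conj_subgroup_mat)
    show "\<exists>g\<in>carrier ((GL2 UNIV)\<lparr>carrier := normalizer_GL2 A\<rparr>). conj_subgroup g H = H'"
      if H': "H' \<in> GL2_subgroups F A" for H'
    proof -
      obtain h h' where h: "h \<in> normalizer_GL2 A" "H = conj_subgroup h (carrier (GL2 F))"
        "h' \<in> normalizer_GL2 A" "H' = conj_subgroup h' (carrier (GL2 F))"
        using H H' unfolding GL2_subgroups_eq by blast
      have "conj_subgroup (h' ** matrix_inv h) H = H'"
        using h by (simp add: conj_subgroup_mult conj_subgroup_inv normalizer_GL2_iff det_matrix_inv)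
      then show ?thesis
        using normalizer_GL2_mult[OF subring h(3) normalizer_GL2_inv[OF subring h(1)]] by auto
    qed
    fix g assume g: "g \<in> carrier ((GL2 UNIV)\<lparr>carrier := normalizer_GL2 A\<rparr>)"
    then show "conj_subgroup g H \<in> GL2_subgroups F A"
      using conj_subgroup_in_GL2_subgroups[OF _ H] by simp
    show "g \<in> scalars_GL2 A" if "\<gamma> \<in> carrier (GL2 A)" "conj_subgroup g H = conj_subgroup \<gamma> H" for \<gamma>
      using conj_eq_imp_scalars[OF _ that(1) H that(2)] g by simp
    fix h assume "h \<in> carrier ((GL2 UNIV)\<lparr>carrier := normalizer_GL2 A\<rparr>)"
    then show "conj_subgroup (g \<otimes>\<^bsub>(GL2 UNIV)\<lparr>carrier := normalizer_GL2 A\<rparr>\<^esub> h) H = conj_subgroup g (conj_subgroup h H)"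
      using g by (simp add: conj_subgroup_mult normalizer_GL2_iff)
  qed
  then show ?thesis unfolding quinn_class_eq Quinn_def by simp
qed

end


section \<open>Lattices over a valuation ring\<close>

definition std_lattice :: "'c::field set \<Rightarrow> ('c^2) set" where
  "std_lattice R = {x. \<forall>i. x $ i \<in> R}"

lemma valuation_ringD: "valuation_ring R \<Longrightarrow> is_subring R" "valuation_ring R \<Longrightarrow> x \<in> R \<or> inverse x \<in> R"
  unfolding valuation_ring_def by blast+

text \<open>Divisibility with quotients in a valuation ring is a total preorder, so some element of
  a finite set divides all others. It is 0 only if all elements are.\<close>

lemma valuation_ring_generator:
  assumes R: "valuation_ring R" and B: "finite B" "B \<noteq> {}"
  shows "\<exists>c\<in>B. \<forall>b\<in>B. \<exists>r\<in>R. b = r * c"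
  using B
proof (induction B rule: finite_ne_induct)
  note r = is_subringD[OF valuation_ringD(1)[OF R]]
  case (singleton b)
  show ?case using r(1) by (auto intro!: bexI[of _ 1])
next
  note r = is_subringD[OF valuation_ringD(1)[OF R]]
  case (insert b B)
  then obtain c where c: "c \<in> B" "\<And>x. x \<in> B \<Longrightarrow> \<exists>r\<in>R. x = r * c" by blast
  show ?case
  proof (cases "\<exists>r\<in>R. b = r * c")
    case True
    then show ?thesis using c by (intro bexI[of _ c]) auto
  next
    case False
    have "\<exists>r\<in>R. c = r * b"
    proof (cases "c = 0")
      case True
      then show ?thesis using r(2) by (intro bexI[of _ 0]) auto
    next
      case c0: False
      have "b \<noteq> 0" using False r(2) by (metis mult_zero_left)
      have "b = b / c * c" using c0 by simp
      then have "b / c \<notin> R" using False by blast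
      then have "c / b \<in> R" using valuation_ringD(2)[OF R, of "b / c"] by simp
      then show ?thesis using \<open>b \<noteq> 0\<close> by (intro bexI[of _ "c / b"]) auto
    qed
    then obtain q where q: "q \<in> R" "c = q * b" by blast
    have "\<exists>r\<in>R. x = r * b" if "x \<in> B" for x
    proof -
      obtain s where "s \<in> R" "x = s * c" using c(2)[OF \<open>x \<in> B\<close>] by blast
      then show ?thesis using q r(4) by (intro bexI[of _ "s * q"]) auto
    qed
    moreover have "\<exists>r\<in>R. b = r * b" using r(1) by (intro bexI[of _ 1]) auto
    ultimately show ?thesis by blast
  qed
qed

lemma lattice_spanI: "(\<And>s. s \<in> S \<Longrightarrow> c s \<in> R) \<Longrightarrow> (\<Sum>s\<in>S. c s *s s) \<in> lattice_span R S"
  unfolding lattice_span_def by blast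

lemma lattice_span_closed:
  assumes R: "is_subring R" and S: "finite S"
  shows "x \<in> lattice_span R S \<Longrightarrow> y \<in> lattice_span R S \<Longrightarrow> x + y \<in> lattice_span R S"
    and "r \<in> R \<Longrightarrow> x \<in> lattice_span R S \<Longrightarrow> r *s x \<in> lattice_span R S"
    and "s \<in> S \<Longrightarrow> s \<in> lattice_span R S"
proof -
  note r = is_subringD[OF R]
  show "x + y \<in> lattice_span R S" if xy: "x \<in> lattice_span R S" "y \<in> lattice_span R S"
  proof -
    obtain c d where "x = (\<Sum>s\<in>S. c s *s s)" "y = (\<Sum>s\<in>S. d s *s s)" "\<forall>s\<in>S. c s \<in> R" "\<forall>s\<in>S. d s \<in> R"
      using xy unfolding lattice_span_def by blast
    then have "x + y = (\<Sum>s\<in>S. (c s + d s) *s s)" "\<forall>s\<in>S. c s + d s \<in> R"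
      using r(6) by (simp_all add: sum.distrib vec.scale_left_distrib)
    then show ?thesis using lattice_spanI[of S "\<lambda>s. c s + d s"] by simp
  qed
  show "r *s x \<in> lattice_span R S" if r_x: "r \<in> R" "x \<in> lattice_span R S"
  proof -
    obtain c where "x = (\<Sum>s\<in>S. c s *s s)" "\<forall>s\<in>S. c s \<in> R"
      using r_x unfolding lattice_span_def by blast
    then have "r *s x = (\<Sum>s\<in>S. (r * c s) *s s)" "\<forall>s\<in>S. r * c s \<in> R"
      using r(4) r_x(1) by (simp_all add: vec.scale_sum_right)
    then show ?thesis using lattice_spanI[of S "\<lambda>s. r * c s"] by simp
  qed
  show "s \<in> lattice_span R S" if "s \<in> S"
  proof -
    have "(\<Sum>t\<in>S. (if t = s then 1 else 0) *s t) = (\<Sum>t\<in>S. if t = s then t else 0)"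
      by (rule sum.cong) auto
    also have "\<dots> = s" using S that by (simp add: sum.delta)
    finally have "s = (\<Sum>t\<in>S. (if t = s then 1 else 0) *s t)" ..
    moreover have "(\<Sum>t\<in>S. (if t = s then 1 else 0) *s t) \<in> lattice_span R S"
      using r(1,2) by (intro lattice_spanI) simp
    ultimately show ?thesis by simp
  qed
qed

lemma is_latticeD:
  assumes R: "is_subring R" and L: "is_lattice R L"
  shows "x \<in> L \<Longrightarrow> y \<in> L \<Longrightarrow> x + y \<in> L" "r \<in> R \<Longrightarrow> x \<in> L \<Longrightarrow> r *s x \<in> L"
    "x \<in> L \<Longrightarrow> y \<in> L \<Longrightarrow> x - y \<in> L"
proof -
  show add: "x \<in> L \<Longrightarrow> y \<in> L \<Longrightarrow> x + y \<in> L" and mult: "r \<in> R \<Longrightarrow> x \<in> L \<Longrightarrow> r *s x \<in> L" for x y r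
    using L lattice_span_closed(1,2)[OF R] unfolding is_lattice_def by blast+
  show "x \<in> L \<Longrightarrow> y \<in> L \<Longrightarrow> x - y \<in> L"
    using add[of x "(- 1) *s y"] mult[of "- 1" y] is_subringD(1,5)[OF R] by (simp add: vec.scale_minus_left)
qed

lemma is_lattice_image:
  assumes M: "det M \<noteq> 0" and L: "is_lattice R L"
  shows "is_lattice R ((*v) M ` L)"
proof -
  obtain S where S: "finite S" "L = lattice_span R S" "vec.span L = UNIV"
    using L unfolding is_lattice_def by blast
  have inj: "inj ((*v) M)"
    using M invertible_det_nz[of M] inj_matrix_vector_mult by blast
  have sum: "M *v (\<Sum>s\<in>S. c s *s s) = (\<Sum>s\<in>S. c s *s (M *v s))" for c
    by (simp add: vec.linear_sum matrix_vector_mul_linear_gen vector_scalar_commute vec.sum)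
  have "(*v) M ` L = lattice_span R ((*v) M ` S)"
  proof (intro equalityI subsetI)
    fix y assume "y \<in> (*v) M ` L"
    then obtain c where c: "\<forall>s\<in>S. c s \<in> R" "y = M *v (\<Sum>s\<in>S. c s *s s)"
      unfolding S(2) lattice_span_def by blast
    \<comment> \<open>\<open>lattice_span\<close> sums over a set of vectors, so the coefficients
      have to be carried along the injective map to be well defined on the image.\<close>
    define d where "d t = c (inv_into UNIV ((*v) M) t)" for t
    have d: "d (M *v s) = c s" for s unfolding d_def by (simp add: inv_f_f[OF inj])
    have "y = (\<Sum>t\<in>(*v) M ` S. d t *s t)"
      unfolding c(2) sum by (subst sum.reindex) (use inj in \<open>auto simp: d inj_on_def\<close>)
    moreover have "\<forall>t\<in>(*v) M ` S. d t \<in> R" using c(1) d by auto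
    ultimately show "y \<in> lattice_span R ((*v) M ` S)" unfolding lattice_span_def by blast
  next
    fix y assume "y \<in> lattice_span R ((*v) M ` S)"
    then obtain d where d: "\<forall>t\<in>(*v) M ` S. d t \<in> R" "y = (\<Sum>t\<in>(*v) M ` S. d t *s t)"
      unfolding lattice_span_def by blast
    have "y = (\<Sum>s\<in>S. d (M *v s) *s (M *v s))"
      unfolding d(2) by (subst sum.reindex) (use inj in \<open>auto simp: inj_on_def\<close>)
    then have "y = M *v (\<Sum>s\<in>S. d (M *v s) *s s)" unfolding sum .
    moreover have "(\<Sum>s\<in>S. d (M *v s) *s s) \<in> L"
      unfolding S(2) using d(1) by (intro lattice_spanI) blast
    ultimately show "y \<in> (*v) M ` L" by blast
  qed
  moreover have "vec.span ((*v) M ` L) = UNIV"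
  proof -
    have "vec.span ((*v) M ` L) = (*v) M ` vec.span L"
      by (rule vec.linear_span_image[OF matrix_vector_mul_linear_gen])
    also have "\<dots> = UNIV"
      unfolding S(3) using M matrix_inv_mult(1)[OF M]
      by (metis matrix_vector_mul_assoc matrix_vector_mul_lid surjI)
    finally show ?thesis .
  qed
  ultimately show ?thesis unfolding is_lattice_def using S(1) by blast
qed

lemma vec2_eq: "x = x $ 1 *s vector [1, 0] + x $ 2 *s vector [0, 1]" for x :: "'a::field^2"
  by (simp add: vec_eq_iff forall_2)

lemma is_lattice_std_lattice:
  fixes R :: "'c::field set"
  assumes R: "is_subring R"
  shows "is_lattice R (std_lattice R)"
proof -
  note r = is_subringD[OF R]
  define e f where "e = (vector [1, 0] :: 'c^2)" and "f = (vector [0, 1] :: 'c^2)"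
  have ef: "e \<noteq> f" unfolding e_def f_def by (simp add: vec_eq_iff forall_2)
  have "std_lattice R = lattice_span R {e, f}"
  proof (intro equalityI subsetI)
    fix x assume x: "x \<in> std_lattice R"
    define c where "c t = (if t = e then x $ 1 else x $ 2)" for t
    have "x = (\<Sum>t\<in>{e, f}. c t *s t)"
      using vec2_eq[of x] ef unfolding c_def e_def[symmetric] f_def[symmetric] by auto
    moreover have "\<forall>t\<in>{e, f}. c t \<in> R" using x unfolding std_lattice_def c_def by simp
    ultimately show "x \<in> lattice_span R {e, f}" unfolding lattice_span_def by blast
  next
    fix x assume "x \<in> lattice_span R {e, f}"
    then obtain c where "x = (\<Sum>t\<in>{e, f}. c t *s t)" "c e \<in> R" "c f \<in> R" unfolding lattice_span_def by blast
    then show "x \<in> std_lattice R"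
      using ef by (simp add: std_lattice_def forall_2 e_def f_def)
  qed
  moreover have "x \<in> vec.span (std_lattice R)" for x
  proof -
    have "e \<in> std_lattice R" "f \<in> std_lattice R"
      using r(1,2) by (simp_all add: std_lattice_def forall_2 e_def f_def)
    then have "x $ 1 *s e + x $ 2 *s f \<in> vec.span (std_lattice R)"
      by (intro vec.span_add vec.span_scale vec.span_base)
    then show ?thesis using vec2_eq[of x] unfolding e_def f_def by simp
  qed
  ultimately show ?thesis unfolding is_lattice_def by (intro conjI exI[of _ "{e, f}"]) auto
qed

text \<open>Applying the involution to M L = a L gives M L = (1/a) L, and one of \<open>a\<close>,
  \<open>1/a\<close> lies in \<open>R\<close>. Thus an involution that fixes the homothety class
  preserves the lattice itself.\<close>

lemma involution_preserves_lattice: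
  assumes R: "valuation_ring R" and L: "is_lattice R L" and M: "M ** M = mat 1"
    and a: "a \<noteq> 0" "(*v) M ` L = (*s) a ` L"
    and x: "x \<in> L"
  shows "M *v x \<in> L"
proof (cases "a \<in> R")
  case True
  have "M *v x \<in> (*s) a ` L" using a(2) x by blast
  then obtain y where "y \<in> L" "M *v x = a *s y" by blast
  then show ?thesis using is_latticeD(2)[OF valuation_ringD(1)[OF R] L True] by simp
next
  case False
  then have ia: "inverse a \<in> R" using valuation_ringD(2)[OF R] by blast
  have "a *s x \<in> (*v) M ` L" using a(2) x by blast
  then obtain z where z: "z \<in> L" "a *s x = M *v z" by blast
  have "a *s (M *v x) = M *v (a *s x)" by (simp add: vector_scalar_commute)
  also have "\<dots> = z" unfolding z(2) by (simp add: matrix_vector_mul_assoc M)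
  finally have "M *v x = inverse a *s z" using a(1) by auto
  then show ?thesis using is_latticeD(2)[OF valuation_ringD(1)[OF R] L ia z(1)] by simp
qed

text \<open>First coordinates of vectors in \<open>L\<close> are multiples of one of them,
  \<open>c\<close>; by the swap so are second coordinates, which bounds \<open>L\<close> above by
  \<open>c\<close> times the standard lattice. Conversely both multiples \<open>(c, 0)\<close> and
  \<open>(0, c)\<close> of the basis vectors lie in \<open>L\<close>.\<close>

lemma stable_lattice_is_multiple:
  fixes R :: "'c::field set"
  assumes R: "valuation_ring R" and L: "is_lattice R L"
    and stable: "\<And>M x. M \<in> {mat2 0 1 1 0, mat2 1 1 0 (- 1), mat2 1 0 0 (- 1)} \<Longrightarrow> x \<in> L \<Longrightarrow> M *v x \<in> L"
  shows "\<exists>c\<noteq>0. L = (*s) c ` std_lattice R"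
proof -
  note RR = valuation_ringD(1)[OF R]
  note r = is_subringD[OF RR] and l = is_latticeD[OF RR L]
  obtain S where S: "finite S" "L = lattice_span R S" "vec.span L = UNIV"
    using L unfolding is_lattice_def by blast
  have nz: "\<not> L \<subseteq> {0}"
  proof
    assume "L \<subseteq> {0}"
    then have "vec.span L \<subseteq> {0}" using vec.span_mono[of L "{0}"] by simp
    then have "(vector [1, 0] :: 'c^2) = 0" using S(3) by blast
    then show False by (simp add: vec_eq_iff forall_2)
  qed
  have "S \<noteq> {}" using nz unfolding S(2) lattice_span_def by auto
  then obtain s c where s: "s \<in> S" "c = s $ 1" and c: "\<And>t. t \<in> S \<Longrightarrow> \<exists>q\<in>R. t $ 1 = q * c"
    using valuation_ring_generator[OF R, of "(\<lambda>t. t $ 1) ` S"] S(1) by auto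
  have swap: "vector [x $ 2, x $ 1] \<in> L" if "x \<in> L" for x
    using stable[OF _ that, of "mat2 0 1 1 0"] by (simp add: mat2_mult_vec)
  have fst: "x $ 1 \<in> (\<lambda>q. q * c) ` R" if x: "x \<in> L" for x
  proof -
    obtain d where d: "x = (\<Sum>t\<in>S. d t *s t)" "\<forall>t\<in>S. d t \<in> R" using x unfolding S(2) lattice_span_def by blast
    obtain q where q: "\<And>t. t \<in> S \<Longrightarrow> q t \<in> R \<and> t $ 1 = q t * c" using c by metis
    have "x $ 1 = (\<Sum>t\<in>S. d t * q t) * c"
      unfolding d(1) sum_component sum_distrib_right using q by (intro sum.cong) auto
    moreover have "(\<Sum>t\<in>S. d t * q t) \<in> R"
      using d(2) q r(4) by (intro is_subring_sum[OF RR]) auto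
    ultimately show ?thesis by blast
  qed
  have e: "vector [c, 0] \<in> L"
  proof -
    have sw: "vector [s $ 2, s $ 1] \<in> L" using swap lattice_span_closed(3)[OF RR S(1) s(1)] S(2) by blast
    \<comment> \<open>The difference of the two involutions is the matrix unit E12 in every
      characteristic. It sends the swapped generator to \<open>(c, 0)\<close>.\<close>
    have "mat2 1 1 0 (- 1) *v vector [s $ 2, s $ 1] - mat2 1 0 0 (- 1) *v vector [s $ 2, s $ 1] \<in> L"
      by (intro l(3) stable sw) simp_all
    also have "mat2 1 1 0 (- 1) *v vector [s $ 2, s $ 1] - mat2 1 0 0 (- 1) *v vector [s $ 2, s $ 1] = vector [c, 0]"
      by (simp add: mat2_mult_vec vec_eq_iff forall_2 s(2))
    finally show ?thesis .
  qed
  have f: "vector [0, c] \<in> L" using swap[OF e] by simp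
  have "L = (*s) c ` std_lattice R"
  proof (intro equalityI subsetI)
    fix x assume x: "x \<in> L"
    obtain p q where pq: "p \<in> R" "x $ 1 = p * c" "q \<in> R" "x $ 2 = q * c"
      using fst[OF x] fst[OF swap[OF x]] by auto
    have "x = c *s vector [p, q]" using pq by (simp add: vec_eq_iff forall_2 mult.commute)
    moreover have "vector [p, q] \<in> std_lattice R" using pq by (simp add: std_lattice_def forall_2)
    ultimately show "x \<in> (*s) c ` std_lattice R" by blast
  next
    fix x assume "x \<in> (*s) c ` std_lattice R"
    then obtain y where y: "x = c *s y" "y $ 1 \<in> R" "y $ 2 \<in> R" by (auto simp: std_lattice_def)
    have "x = y $ 1 *s vector [c, 0] + y $ 2 *s vector [0, c]"
      unfolding y(1) by (simp add: vec_eq_iff forall_2 mult.commute)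
    then show "x \<in> L" using y(2,3) e f l(1,2) by simp
  qed
  moreover have "c \<noteq> 0"
  proof
    assume "c = 0"
    then have "L \<subseteq> {0}" unfolding \<open>L = (*s) c ` std_lattice R\<close> by auto
    then show False using nz by blast
  qed
  ultimately show ?thesis by blast
qed

section \<open>The action on the Bruhat--Tits tree\<close>

lemma verts_bruhat_tits_tree: "verts (bruhat_tits_tree R) = {homothety_class L | L. is_lattice R L}"
  by (simp add: bruhat_tits_tree_def Let_def)

lemma homothety_class_self: "L \<in> homothety_class L"
  unfolding homothety_class_def by (auto intro!: exI[of _ 1])

lemma homothety_class_scale:
  assumes c: "c \<noteq> 0"
  shows "homothety_class ((*s) c ` L) = homothety_class L"
proof (intro equalityI subsetI)
  fix K assume "K \<in> homothety_class ((*s) c ` L)"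
  then obtain a where "a \<noteq> 0" "K = (*s) (a * c) ` L" unfolding homothety_class_def by (auto simp: image_image)
  then show "K \<in> homothety_class L" unfolding homothety_class_def using c by auto
next
  fix K assume "K \<in> homothety_class L"
  then obtain a where a: "a \<noteq> 0" "K = (*s) a ` L" unfolding homothety_class_def by auto
  then have "a / c \<noteq> 0" "K = (*s) (a / c) ` (*s) c ` L" using c by (auto simp: image_image)
  then show "K \<in> homothety_class ((*s) c ` L)" unfolding homothety_class_def by blast
qed

lemma homothety_class_eqD:
  assumes "homothety_class K = homothety_class L"
  shows "\<exists>a\<noteq>0. K = (*s) a ` L"
  using homothety_class_self[of K] unfolding assms unfolding homothety_class_def by blast

lemma bt_act_homothety_class:
  fixes \<iota> :: "'a::field \<Rightarrow> 'b::field"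
  shows "bt_act \<iota> g (homothety_class L) = homothety_class ((*v) (map_matrix \<iota> g) ` L)"
proof -
  have "homothety_class L = (\<lambda>a. (*s) a ` L) ` (- {0})" for L :: "('b^2) set"
    unfolding homothety_class_def by auto
  then show ?thesis unfolding bt_act_def by (simp add: image_image vector_scalar_commute)
qed

lemma map_matrix_mat2: "map_matrix \<iota> (mat2 a b c d) = mat2 (\<iota> a) (\<iota> b) (\<iota> c) (\<iota> d)"
  by (simp add: vec_eq_iff forall_2)

text \<open>\<open>integral_constant\<close> and \<open>unit_constant\<close> are where the
  existence of places enters the geometry of the tree.\<close>

locale completed_constants = constants_in_ring F A for F A :: "'k::field set" +
  fixes P :: "'k set" and \<iota> :: "'k \<Rightarrow> 'c::field" and R :: "'c set"
  assumes F_subset_P: "F \<subseteq> P"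
    and integral_constant: "\<And>x. x \<in> A \<Longrightarrow> x \<in> P \<Longrightarrow> x \<in> F"
    and unit_constant: "\<And>x. x \<in> A \<Longrightarrow> inverse x \<in> A \<Longrightarrow> x \<in> F"
    and \<iota>_one: "\<iota> 1 = 1" and \<iota>_add: "\<And>x y. \<iota> (x + y) = \<iota> x + \<iota> y"
    and \<iota>_mult: "\<And>x y. \<iota> (x * y) = \<iota> x * \<iota> y"
    and R: "valuation_ring R" and \<iota>_R: "\<And>x. \<iota> x \<in> R \<longleftrightarrow> x \<in> P"
begin

lemma \<iota>_zero: "\<iota> 0 = 0"
  using \<iota>_add[of 0 0] add_left_cancel[of "\<iota> 0" "\<iota> 0" 0] by simp

lemma \<iota>_minus: "\<iota> (- x) = - \<iota> x"
  using \<iota>_add[of x "- x"] \<iota>_zero by (simp add: eq_neg_iff_add_eq_0 add.commute)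

lemma \<iota>_diff: "\<iota> (x - y) = \<iota> x - \<iota> y"
  using \<iota>_add[of x "- y"] \<iota>_minus by simp

lemma \<iota>_nonzero: "x \<noteq> 0 \<Longrightarrow> \<iota> x \<noteq> 0"
  using \<iota>_mult[of x "inverse x"] \<iota>_one by auto

lemma map_matrix_mult: "map_matrix \<iota> (g ** h) = map_matrix \<iota> g ** map_matrix \<iota> h"
  for g h :: "'k^2^2"
  by (cases g rule: mat2_cases; cases h rule: mat2_cases)
    (simp add: map_matrix_mat2 mat2_mult \<iota>_add \<iota>_mult)

lemma map_matrix_mat: "map_matrix \<iota> (mat c) = (mat (\<iota> c) :: 'c^2^2)"
  by (simp add: mat_eq_mat2 map_matrix_mat2 \<iota>_zero)

lemma det_map_matrix: "det (map_matrix \<iota> g) = \<iota> (det g)" for g :: "'k^2^2"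
  by (cases g rule: mat2_cases) (simp add: map_matrix_mat2 det_mat2 \<iota>_diff \<iota>_mult)

lemma bt_act_mult: "bt_act \<iota> (g ** h) v = bt_act \<iota> g (bt_act \<iota> h v)"
  by (simp add: bt_act_def map_matrix_mult image_image matrix_vector_mul_assoc)

lemma bt_act_one: "bt_act \<iota> (mat 1) v = v"
  by (simp add: bt_act_def map_matrix_mat \<iota>_one)

lemma bt_act_inv:
  assumes "det g \<noteq> 0"
  shows "bt_act \<iota> (matrix_inv g) (bt_act \<iota> g v) = v" "bt_act \<iota> g (bt_act \<iota> (matrix_inv g) v) = v"
  using assms by (simp_all add: bt_act_one matrix_inv_mult flip: bt_act_mult)

lemma bt_act_verts:
  assumes "det g \<noteq> 0" "v \<in> verts (bruhat_tits_tree R)"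
  shows "bt_act \<iota> g v \<in> verts (bruhat_tits_tree R)"
proof -
  obtain L where L: "is_lattice R L" "v = homothety_class L"
    using assms(2) unfolding verts_bruhat_tits_tree by blast
  have "is_lattice R ((*v) (map_matrix \<iota> g) ` L)"
    by (rule is_lattice_image[OF _ L(1)]) (simp add: det_map_matrix \<iota>_nonzero assms(1))
  then show ?thesis unfolding verts_bruhat_tits_tree L(2) bt_act_homothety_class by blast
qed

lemma bt_act_mat:
  assumes c: "c \<noteq> 0" and v: "v \<in> verts (bruhat_tits_tree R)"
  shows "bt_act \<iota> (mat c) v = v"
proof -
  obtain L where L: "v = homothety_class L" using v unfolding verts_bruhat_tits_tree by blast
  have "(*v) (mat (\<iota> c)) = ((*s) (\<iota> c) :: 'c^2 \<Rightarrow> 'c^2)"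
    by (rule ext) (simp add: mat_eq_mat2 mat2_mult_vec vec_eq_iff forall_2)
  then show ?thesis
    unfolding L bt_act_homothety_class map_matrix_mat using homothety_class_scale[OF \<iota>_nonzero[OF c]] by simp
qed

section \<open>Vertex stabilizers\<close>

abbreviation stab :: "('c^2) set set \<Rightarrow> ('k^2^2) set" where
  "stab v \<equiv> stabilizer (GL2 A) (bt_act \<iota>) v"

lemma subgroup_stab: "subgroup (stab v) (GL2 A)"
proof (rule group.subgroupI[OF group_GL2[OF subring]])
  show "stab v \<subseteq> carrier (GL2 A)" unfolding stabilizer_def by blast
  show "stab v \<noteq> {}" unfolding stabilizer_def using carrier_GL2_one[OF subring] bt_act_one by blast
  fix g assume "g \<in> stab v"
  then have g: "g \<in> carrier (GL2 A)" "bt_act \<iota> g v = v" unfolding stabilizer_def by auto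
  have "bt_act \<iota> (matrix_inv g) v = v" using bt_act_inv(1)[OF carrier_GL2_det[OF g(1)], of v] g(2) by simp
  then show "inv\<^bsub>GL2 A\<^esub> g \<in> stab v"
    unfolding inv_GL2_subring[OF subring g(1)] stabilizer_def using carrier_GL2_inv[OF g(1)] by blast
  fix h assume "h \<in> stab v"
  then show "g \<otimes>\<^bsub>GL2 A\<^esub> h \<in> stab v"
    using g carrier_GL2_mult[OF subring] unfolding stabilizer_def by (auto simp: bt_act_mult)
qed

text \<open>The passage from vertices to stabilizers is equivariant for the whole normalizer,
  because the elements of \<open>GL2 A\<close> are exactly the conjugates by \<open>g\<close> of
  elements of \<open>GL2 A\<close>.\<close>

lemma stab_bt_act:
  assumes g: "g \<in> normalizer_GL2 A"
  shows "stab (bt_act \<iota> g v) = conj_subgroup g (stab v)"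
proof -
  have d: "det g \<noteq> 0" and conj: "conj_subgroup g (carrier (GL2 A)) = carrier (GL2 A)"
    using g unfolding normalizer_GL2_iff by auto
  have iff: "bt_act \<iota> (g ** h ** matrix_inv g) (bt_act \<iota> g v) = bt_act \<iota> g v \<longleftrightarrow> bt_act \<iota> h v = v" for h
    using bt_act_inv[OF d] by (metis bt_act_mult)
  have "stab (bt_act \<iota> g v) = {k \<in> conj_subgroup g (carrier (GL2 A)). bt_act \<iota> k (bt_act \<iota> g v) = bt_act \<iota> g v}"
    unfolding stabilizer_def conj ..
  also have "\<dots> = conj_subgroup g (stab v)"
    unfolding conj_subgroup_eq[OF d] stabilizer_def using iff by blast
  finally show ?thesis .
qed

definition v0 :: "('c^2) set set" where
  "v0 = homothety_class (std_lattice R)"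

lemma v0_verts: "v0 \<in> verts (bruhat_tits_tree R)"
  unfolding v0_def verts_bruhat_tits_tree using is_lattice_std_lattice[OF valuation_ringD(1)[OF R]] by blast

lemma std_lattice_image_subset:
  assumes "g \<in> matrices_over P"
  shows "(*v) (map_matrix \<iota> g) ` std_lattice R \<subseteq> std_lattice R"
proof
  note r = is_subringD[OF valuation_ringD(1)[OF R]]
  fix y assume "y \<in> (*v) (map_matrix \<iota> g) ` std_lattice R"
  then obtain x where "y = map_matrix \<iota> g *v x" "\<And>i. x $ i \<in> R" unfolding std_lattice_def by blast
  moreover have "\<iota> (g $ i $ j) \<in> R" for i j using assms \<iota>_R unfolding matrices_over_def by blast
  ultimately show "y \<in> std_lattice R"
    unfolding std_lattice_def by (simp add: matrix_vector_mult_def sum_2 r)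
qed

lemma GL2_F_fixes_v0:
  assumes g: "g \<in> carrier (GL2 F)"
  shows "bt_act \<iota> g v0 = v0"
proof -
  have P: "g \<in> matrices_over P" "matrix_inv g \<in> matrices_over P"
    using carrier_GL2_matrices[OF g] carrier_GL2_matrices[OF carrier_GL2_inv[OF g]] F_subset_P
    unfolding matrices_over_def by auto
  have "std_lattice R = (*v) (map_matrix \<iota> g) ` (*v) (map_matrix \<iota> (matrix_inv g)) ` std_lattice R"
    using matrix_inv_mult(1)[OF carrier_GL2_det[OF g]]
    by (simp add: image_image matrix_vector_mul_assoc map_matrix_mat \<iota>_one flip: map_matrix_mult)
  then have "(*v) (map_matrix \<iota> g) ` std_lattice R = std_lattice R"
    using std_lattice_image_subset[OF P(1)] std_lattice_image_subset[OF P(2)] by blast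
  then show ?thesis unfolding v0_def bt_act_homothety_class by simp
qed

text \<open>Fixing the class gives only that \<open>g\<close> maps the standard lattice to
  \<open>a\<close> times itself, with \<open>a\<close> unknown. This puts the entries of
  \<open>g\<close> into \<open>a R\<close> and, because \<open>det g\<close> is a constant, also
  into \<open>(1/a) R\<close>; one of these lies in \<open>R\<close>. The entries are then integral
  at \<open>P\<close> as well, hence constants.\<close>

lemma stab_v0: "stab v0 = carrier (GL2 F)"
proof (intro equalityI subsetI)
  fix g assume "g \<in> stab v0"
  then have g: "g \<in> carrier (GL2 A)" "bt_act \<iota> g v0 = v0" unfolding stabilizer_def by auto
  note r = is_subringD[OF valuation_ringD(1)[OF R]] and as = is_subringD[OF subring]
  obtain a where a: "a \<noteq> 0" "(*v) (map_matrix \<iota> g) ` std_lattice R = (*s) a ` std_lattice R"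
    using g(2) homothety_class_eqD unfolding v0_def bt_act_homothety_class by blast
  have entry: "(M *v axis j 1) $ i = M $ i $ j" for M :: "'c^2^2" and i j
    using exhaust_2[of j] by (auto simp: matrix_vector_mult_def axis_def sum_2)
  have e: "axis j 1 \<in> std_lattice R" for j
    using r(1,2) by (simp add: std_lattice_def axis_def)
  have d: "det g \<noteq> 0" using carrier_GL2_det[OF g(1)] .
  have det_A: "det h \<in> A" if "h \<in> matrices_over A" for h
    using that as by (cases h rule: mat2_cases) (simp add: det_mat2)
  \<comment> \<open>The determinants of \<open>g\<close> and of its inverse both lie in
    \<open>A\<close>, so \<open>det g\<close> is a unit of \<open>A\<close>.\<close>
  have det_F: "det g \<in> F"
    using unit_constant[OF det_A[OF carrier_GL2_matrices[OF g(1)]]]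
      det_A[OF carrier_GL2_matrices[OF carrier_GL2_inv[OF g(1)]]] det_matrix_inv[OF d] by simp
  have up: "\<exists>q\<in>R. \<iota> (g $ i $ j) = a * q" for i j
  proof -
    have "map_matrix \<iota> g *v axis j 1 \<in> (*s) a ` std_lattice R" using a(2) e by blast
    then obtain z where "z \<in> std_lattice R" "map_matrix \<iota> g *v axis j 1 = a *s z" by blast
    then show ?thesis using entry[of "map_matrix \<iota> g" j i] unfolding std_lattice_def
      by (intro bexI[of _ "z $ i"]) simp_all
  qed
  have "a * \<iota> (matrix_inv g $ i $ j) \<in> R" for i j
  proof -
    have "a *s axis j 1 \<in> (*v) (map_matrix \<iota> g) ` std_lattice R" using a(2) e by blast
    then obtain z where z: "z \<in> std_lattice R" "a *s axis j 1 = map_matrix \<iota> g *v z" by blast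
    have "a *s (map_matrix \<iota> (matrix_inv g) *v axis j 1) = map_matrix \<iota> (matrix_inv g) *v (a *s axis j 1)"
      by (simp add: vector_scalar_commute)
    also have "\<dots> = z"
      unfolding z(2) by (simp add: matrix_vector_mul_assoc matrix_inv_mult(2)[OF d] map_matrix_mat \<iota>_one flip: map_matrix_mult)
    finally have "a * (map_matrix \<iota> (matrix_inv g) *v axis j 1) $ i = z $ i" by (simp flip: vector_smult_component)
    then show ?thesis using z(1) unfolding entry std_lattice_def by auto
  qed
  then have "a * \<iota> (matrix_inv g $ i $ j) * \<iota> (det g) \<in> R" for i j
    using r(4) det_F F_subset_P \<iota>_R by blast
  then have inv_entry: "a * \<iota> (matrix_inv g $ i $ j * det g) \<in> R" for i j
    by (simp add: \<iota>_mult mult.assoc)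
  \<comment> \<open>Up to order and sign, \<open>det g\<close> times the inverse has the entries of
    \<open>g\<close>.\<close>
  have down: "a * \<iota> (g $ i $ j) \<in> R" for i j
  proof (cases g rule: mat2_cases)
    case (1 p q s t)
    have inv: "matrix_inv g $ i $ j * det g = mat2 t (- q) (- s) p $ i $ j" for i j
      using d unfolding 1 det_mat2 using matrix_inv_mat2[of p t q s] exhaust_2[of i] exhaust_2[of j] by auto
    have "a * \<iota> t \<in> R" "a * \<iota> (- q) \<in> R" "a * \<iota> (- s) \<in> R" "a * \<iota> p \<in> R"
      using inv_entry[of 1 1] inv_entry[of 1 2] inv_entry[of 2 1] inv_entry[of 2 2] unfolding inv by simp_all
    then show ?thesis
      using r(5)[of "a * \<iota> (- q)"] r(5)[of "a * \<iota> (- s)"] exhaust_2[of i] exhaust_2[of j]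
      unfolding 1 by (auto simp: \<iota>_minus)
  qed
  have "g $ i $ j \<in> F" for i j
  proof -
    obtain q where q: "q \<in> R" "\<iota> (g $ i $ j) = a * q" using up by blast
    have "\<iota> (g $ i $ j) \<in> R"
    proof (cases "a \<in> R")
      case True
      then show ?thesis using q r(4) by simp
    next
      case False
      then have "inverse a * (a * \<iota> (g $ i $ j)) \<in> R"
        using valuation_ringD(2)[OF R, of a] down[of i j] r(4) by blast
      moreover have "inverse a * (a * \<iota> (g $ i $ j)) = \<iota> (g $ i $ j)"
        using a(1) by (simp add: mult.assoc[symmetric])
      ultimately show ?thesis by simp
    qed
    then show ?thesis
      using integral_constant \<iota>_R carrier_GL2_matrices[OF g(1)] unfolding matrices_over_def by blast
  qed
  then show "g \<in> carrier (GL2 F)"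
    using carrier_GL2_subfield[OF subfield _ d] unfolding matrices_over_def by blast
next
  fix g assume g: "g \<in> carrier (GL2 F)"
  then show "g \<in> stab v0" using GL2_F_fixes_v0 GL2_F_subset unfolding stabilizer_def by blast
qed

text \<open>Three involutions in \<open>GL2 F\<close> already suffice: each preserves the lattice
  and not only its class, and together they force it to be a multiple of the standard one. The size
  of the residue field at \<open>P\<close> does not enter.\<close>

lemma unique_fixed_vertex:
  assumes v: "v \<in> verts (bruhat_tits_tree R)" and fixed: "\<And>g. g \<in> carrier (GL2 F) \<Longrightarrow> bt_act \<iota> g v = v"
  shows "v = v0"
proof -
  obtain L where L: "is_lattice R L" "v = homothety_class L"
    using v unfolding verts_bruhat_tits_tree by blast
  note f = is_subringD[OF subring_F]
  have "M *v x \<in> L" if M: "M \<in> {mat2 0 1 1 0, mat2 1 1 0 (- 1), mat2 1 0 0 (- 1)}" and x: "x \<in> L" for M x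
  proof -
    obtain g where g: "g \<in> carrier (GL2 F)" "M = map_matrix \<iota> g"
    proof -
      have "mat2 0 1 1 0 \<in> carrier (GL2 F)" "mat2 1 1 0 (- 1) \<in> carrier (GL2 F)" "mat2 1 0 0 (- 1) \<in> carrier (GL2 F)"
        using f(1,2) f(5)[OF f(1)] by (auto intro!: mat2_in_GL2[OF subfield])
      moreover have "map_matrix \<iota> (mat2 0 1 1 0) = mat2 0 1 1 0"
        "map_matrix \<iota> (mat2 1 1 0 (- 1)) = mat2 1 1 0 (- 1)" "map_matrix \<iota> (mat2 1 0 0 (- 1)) = mat2 1 0 0 (- 1)"
        by (simp_all add: map_matrix_mat2 \<iota>_zero \<iota>_one \<iota>_minus)
      ultimately show ?thesis using M that by (metis empty_iff insert_iff)
    qed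
    obtain a where "a \<noteq> 0" "(*v) M ` L = (*s) a ` L"
      using fixed[OF g(1)] homothety_class_eqD unfolding L(2) bt_act_homothety_class g(2) by blast
    moreover have "M ** M = mat 1" using M by (auto simp: mat2_mult mat_eq_mat2)
    ultimately show ?thesis using involution_preserves_lattice[OF R L(1)] x by blast
  qed
  then obtain c where "c \<noteq> 0" "L = (*s) c ` std_lattice R"
    using stable_lattice_is_multiple[OF R L(1)] by blast
  then show ?thesis unfolding L(2) v0_def using homothety_class_scale by blast
qed

section \<open>Vertices with stabilizer isomorphic to \<open>GL2 F\<close> and their torsor\<close>

definition GL2_verts :: "('c^2) set set set" where
  "GL2_verts = {v \<in> verts (bruhat_tits_tree R). (GL2 A)\<lparr>carrier := stab v\<rparr> \<cong> GL2 F}"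

lemma stab_GL2_verts: "v \<in> GL2_verts \<Longrightarrow> stab v \<in> GL2_subgroups F A"
  unfolding GL2_verts_def GL2_subgroups_def using subgroup_stab by blast

lemma bt_act_GL2_verts:
  assumes "g \<in> normalizer_GL2 A" "v \<in> GL2_verts"
  shows "bt_act \<iota> g v \<in> GL2_verts"
  using conj_subgroup_in_GL2_subgroups[OF assms(1) stab_GL2_verts[OF assms(2)]] assms
    bt_act_verts[of g v] stab_bt_act[OF assms(1), of v]
  unfolding GL2_verts_def GL2_subgroups_def normalizer_GL2_iff by auto

text \<open>The stabilizer of \<open>v\<close> is a conjugate of \<open>GL2 F\<close> by some
  \<open>g\<close> in the normalizer. Moving \<open>v\<close> back by \<open>g\<close> gives a
  vertex fixed by \<open>GL2 F\<close>, and \<open>v0\<close> is the only one.\<close>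

lemma GL2_verts_orbit:
  assumes v: "v \<in> GL2_verts"
  shows "\<exists>g\<in>normalizer_GL2 A. v = bt_act \<iota> g v0"
proof -
  obtain g where g: "g \<in> normalizer_GL2 A" "stab v = conj_subgroup g (carrier (GL2 F))"
    using stab_GL2_verts[OF v] unfolding GL2_subgroups_eq by blast
  have d: "det g \<noteq> 0" using g(1) unfolding normalizer_GL2_iff by blast
  have "stab (bt_act \<iota> (matrix_inv g) v) = carrier (GL2 F)"
    unfolding stab_bt_act[OF normalizer_GL2_inv[OF subring g(1)]] g(2) by (rule conj_subgroup_inv[OF d])
  then have "bt_act \<iota> h (bt_act \<iota> (matrix_inv g) v) = bt_act \<iota> (matrix_inv g) v" if "h \<in> carrier (GL2 F)" for h
    using that unfolding stabilizer_def by blast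
  moreover have "bt_act \<iota> (matrix_inv g) v \<in> verts (bruhat_tits_tree R)"
    using v d unfolding GL2_verts_def by (intro bt_act_verts) (auto simp: det_matrix_inv)
  ultimately have "bt_act \<iota> (matrix_inv g) v = v0" using unique_fixed_vertex by blast
  then show ?thesis using bt_act_inv(2)[OF d, of v] g(1) by metis
qed

lemma v0_GL2_verts: "v0 \<in> GL2_verts"
proof -
  have "(GL2 A)\<lparr>carrier := carrier (GL2 F)\<rparr> = GL2 F" by (simp add: GL2_def)
  then show ?thesis unfolding GL2_verts_def using v0_verts iso_refl by (simp add: stab_v0)
qed

lemma vertex_class_self: "v \<in> vertex_class A \<iota> v"
  unfolding vertex_class_def orbit_def using carrier_GL2_one[OF subring] bt_act_one[of v] by force

text \<open>\<open>GL2_vertices\<close> tests every vertex of an orbit; by invariance of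
  \<open>GL2_verts\<close> under \<open>GL2 A\<close> it is enough to test one.\<close>

lemma GL2_vertices_eq: "GL2_vertices F A \<iota> R = vertex_class A \<iota> ` GL2_verts"
proof (intro equalityI subsetI)
  fix w assume "w \<in> GL2_vertices F A \<iota> R"
  then obtain v where v: "v \<in> verts (bruhat_tits_tree R)" "w = vertex_class A \<iota> v"
    and iso: "\<And>u. u \<in> w \<Longrightarrow> (GL2 A)\<lparr>carrier := stab u\<rparr> \<cong> GL2 F"
    unfolding GL2_vertices_def quotient_graph_def orbits_def vertex_class_def by auto
  then show "w \<in> vertex_class A \<iota> ` GL2_verts"
    unfolding GL2_verts_def using vertex_class_self[of v] by blast
next
  fix w assume "w \<in> vertex_class A \<iota> ` GL2_verts"
  then obtain v where v: "v \<in> GL2_verts" "w = vertex_class A \<iota> v" by blast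
  have "u \<in> GL2_verts" if "u \<in> w" for u
    using that bt_act_GL2_verts[OF carrier_GL2_normalizer[OF subring] v(1)]
    unfolding v(2) vertex_class_def orbit_def by blast
  then have "\<forall>u\<in>w. (GL2 A)\<lparr>carrier := stab u\<rparr> \<cong> GL2 F" unfolding GL2_verts_def by blast
  moreover have "w \<in> verts (quotient_graph (GL2 A) (bt_act \<iota>) (bruhat_tits_tree R))"
    using v unfolding GL2_verts_def quotient_graph_def orbits_def vertex_class_def by auto
  ultimately show "w \<in> GL2_vertices F A \<iota> R" unfolding GL2_vertices_def by blast
qed

lemma Quinn_torsor_vertices:
  "\<exists>\<psi>. (\<forall>g\<in>normalizer_GL2 A. \<forall>v\<in>GL2_verts.
           \<psi> (quinn_class A g) (vertex_class A \<iota> v) = vertex_class A \<iota> (bt_act \<iota> g v)) \<and>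
        free_transitive_action (Quinn A) (GL2_vertices F A \<iota> R) \<psi>"
proof -
  have "\<exists>\<psi>. (\<forall>g\<in>carrier ((GL2 UNIV)\<lparr>carrier := normalizer_GL2 A\<rparr>). \<forall>v\<in>GL2_verts.
           \<psi> (scalars_GL2 A #>\<^bsub>(GL2 UNIV)\<lparr>carrier := normalizer_GL2 A\<rparr>\<^esub> g) (vertex_class A \<iota> v) = vertex_class A \<iota> (bt_act \<iota> g v)) \<and>
        free_transitive_action ((GL2 UNIV)\<lparr>carrier := normalizer_GL2 A\<rparr> Mod scalars_GL2 A) (vertex_class A \<iota> ` GL2_verts) \<psi>"
  proof (rule quotient_torsor[OF scalars_GL2_normal[OF subring], where G = "carrier (GL2 A)"])
    show "carrier (GL2 A) \<subseteq> scalars_GL2 A" using carrier_GL2_scalars by blast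
    show "GL2_verts \<noteq> {}" using v0_GL2_verts by blast
    show "vertex_class A \<iota> v = (\<lambda>\<gamma>. bt_act \<iota> \<gamma> v) ` carrier (GL2 A)" for v
      unfolding vertex_class_def orbit_def by blast
    fix v assume v: "v \<in> GL2_verts"
    then have vT: "v \<in> verts (bruhat_tits_tree R)" unfolding GL2_verts_def by blast
    show "\<exists>\<gamma>\<in>carrier (GL2 A). bt_act \<iota> s v = bt_act \<iota> \<gamma> v" if s: "s \<in> scalars_GL2 A" for s
    proof -
      obtain c \<gamma> where c: "c \<noteq> 0" "\<gamma> \<in> carrier (GL2 A)" "s = mat c ** \<gamma>"
        using s unfolding scalars_GL2_iff by blast
      then show ?thesis
        using bt_act_mat[OF c(1) bt_act_verts[OF carrier_GL2_det[OF c(2)] vT]] by (auto simp: bt_act_mult)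
    qed
    show "bt_act \<iota> \<one>\<^bsub>(GL2 UNIV)\<lparr>carrier := normalizer_GL2 A\<rparr>\<^esub> v = v"
      by (simp add: bt_act_one)
    show "\<exists>g\<in>carrier ((GL2 UNIV)\<lparr>carrier := normalizer_GL2 A\<rparr>). bt_act \<iota> g v = v'"
      if v': "v' \<in> GL2_verts" for v'
    proof -
      obtain h h' where h: "h \<in> normalizer_GL2 A" "v = bt_act \<iota> h v0" "h' \<in> normalizer_GL2 A" "v' = bt_act \<iota> h' v0"
        using GL2_verts_orbit[OF v] GL2_verts_orbit[OF v'] by blast
      have "det h \<noteq> 0" using h(1) unfolding normalizer_GL2_iff by blast
      then have "bt_act \<iota> (h' ** matrix_inv h) v = v'"
        unfolding h(2,4) bt_act_mult by (simp add: bt_act_inv)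
      then show ?thesis
        using normalizer_GL2_mult[OF subring h(3) normalizer_GL2_inv[OF subring h(1)]] by auto
    qed
    fix g assume "g \<in> carrier ((GL2 UNIV)\<lparr>carrier := normalizer_GL2 A\<rparr>)"
    then have g: "g \<in> normalizer_GL2 A" by simp
    show "bt_act \<iota> g v \<in> GL2_verts" by (rule bt_act_GL2_verts[OF g v])
    \<comment> \<open>Equal images of \<open>v\<close> have equal stabilizers, so \<open>g\<close>
      and \<open>\<gamma>\<close> conjugate the stabilizer of \<open>v\<close> in the same way, and
      freeness on subgroups applies.\<close>
    show "g \<in> scalars_GL2 A" if "\<gamma> \<in> carrier (GL2 A)" "bt_act \<iota> g v = bt_act \<iota> \<gamma> v" for \<gamma>
      by (rule conj_eq_imp_scalars[OF g that(1) stab_GL2_verts[OF v]])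
        (use stab_bt_act[OF g, of v] stab_bt_act[OF carrier_GL2_normalizer[OF subring that(1)], of v] that(2) in simp)
    show "bt_act \<iota> (g \<otimes>\<^bsub>(GL2 UNIV)\<lparr>carrier := normalizer_GL2 A\<rparr>\<^esub> h) v = bt_act \<iota> g (bt_act \<iota> h v)" for h
      by (simp add: bt_act_mult)
  qed
  then show ?thesis unfolding quinn_class_eq Quinn_def GL2_vertices_eq by simp
qed

end

theorem theorem3p13:
  fixes F P A :: "'k::field set"
  assumes "function_field F"
    and "is_place F P"
    and "A = integral_outside F P"
  shows "(\<exists>\<phi>. (\<forall>g\<in>normalizer_GL2 A. \<forall>H\<in>GL2_subgroups F A.
                 \<phi> (quinn_class A g) (conj_class A H) = conj_class A (conj_subgroup g H)) \<and>
              free_transitive_action (Quinn A) (conj_class A ` GL2_subgroups F A) \<phi>) \<and>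
         (\<forall>(\<iota> :: 'k \<Rightarrow> 'c::field) R. is_completion P \<iota> R \<longrightarrow>
            (\<exists>\<psi>. (\<forall>g\<in>normalizer_GL2 A. \<forall>v\<in>verts (bruhat_tits_tree R).
                    vertex_class A \<iota> v \<in> GL2_vertices F A \<iota> R \<longrightarrow>
                    \<psi> (quinn_class A g) (vertex_class A \<iota> v) = vertex_class A \<iota> (bt_act \<iota> g v)) \<and>
                  free_transitive_action (Quinn A) (GL2_vertices F A \<iota> R) \<psi>))"
proof -
  interpret constants_in_ring F A
    using assms(1) is_subring_integral_outside[of F P] subset_integral_outside[of F P] unfolding assms(3)
    by unfold_locales (auto simp: function_field_def)
  have "\<exists>\<psi>. (\<forall>g\<in>normalizer_GL2 A. \<forall>v\<in>verts (bruhat_tits_tree R).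
                    vertex_class A \<iota> v \<in> GL2_vertices F A \<iota> R \<longrightarrow>
                    \<psi> (quinn_class A g) (vertex_class A \<iota> v) = vertex_class A \<iota> (bt_act \<iota> g v)) \<and>
                  free_transitive_action (Quinn A) (GL2_vertices F A \<iota> R) \<psi>"
    if "is_completion P \<iota> R" for \<iota> :: "'k \<Rightarrow> 'c" and R
  proof -
    interpret completed_constants F A P \<iota> R
    proof unfold_locales
      show "F \<subseteq> P" using assms(2) unfolding is_place_def by blast
      show "x \<in> F" if "x \<in> A" "x \<in> P" for x
        using integral_everywhere[OF assms(1,2)] that unfolding assms(3) .
      show "x \<in> F" if "x \<in> A" "inverse x \<in> A" for x
        using integral_outside_units[OF assms(1,2)] that unfolding assms(3) .
    qed (use that in \<open>auto simp: is_completion_def\<close>)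
    \<comment> \<open>A vertex belongs to its own class, so the condition on the class can be
      evaluated at \<open>v\<close>.\<close>
    have "v \<in> GL2_verts" if "v \<in> verts (bruhat_tits_tree R)" "vertex_class A \<iota> v \<in> GL2_vertices F A \<iota> R" for v
      using that vertex_class_self[of v] unfolding GL2_verts_def GL2_vertices_def by blast
    then show ?thesis using Quinn_torsor_vertices by meson
  qed
  then show ?thesis by (intro conjI allI impI Quinn_torsor_subgroups)
qed

end
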